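(* Let $S$ be a cancellative and right amenable monoid and $\lambda$ a left $S$-action on a discrete Abelian group $X$. Let $\bar X=X/\mathrm{Ker}(\lambda)$, where $\mathrm{Ker}(\lambda)=\bigcup_{s\in S}\mathrm{Ker}(\lambda_s)$, and let $\bar\lambda$ be the left $S$-action induced by $\lambda$ on $\bar X$. Then $h_{\mathrm{alg}}(\lambda)=h_{\mathrm{alg}}(\bar\lambda)$.
   Context: A cancellative monoid $S$ is right amenable if it admits a right F{\o}lner net, i.e. a net $\{F_i\}_{i\in I}$ of non-empty finite subsets of $S$ such that $\lim_{i\in I}|F_is\setminus F_i|/|F_i|=0$ for every $s\in S$. A left $S$-action $\lambda$ on an Abelian group $X$ is a family of endomorphisms $\lambda_s$ with $\lambda_1=\mathrm{id}_X$, $\lambda_{st}=\lambda_s\circ\lambda_t$. The set $\mathrm{Ker}(\lambda)$ is a subgroup of $X$ with $\lambda_s(\mathrm{Ker}(\lambda))\subseteq\mathrm{Ker}(\lambda)$ for all $s\in S$, and $\bar\lambda_s(x+\mathrm{Ker}(\lambda))=\lambda_s(x)+\mathrm{Ker}(\lambda)$. Algebraic entropy: for a finite subset $E\subseteq X$ containing $0$ and a non-empty finite $F\subseteq S$ let $T_F(\lambda,E)=\sum_{s\in F}\lambda_s(E)$. For a right F{\o}lner net $\{F_i\}_{i\in I}$ of $S$ put $H_{\mathrm{alg}}(\lambda,E)=\lim_{i\in I}\frac{\log|T_{F_i}(\lambda,E)|}{|F_i|}$ (the limit exists and does not depend on the net), and $h_{\mathrm{alg}}(\lambda)=\sup_E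 H_{\mathrm{alg}}(\lambda,E)\in[0,\infty]$ over all finite $E\subseteq X$ with $0\in E$. *)

theory Defs
  imports "HOL-Algebra.Algebra" "HOL-Analysis.Analysis"
begin

section \<open>Nets\<close>

definition directed_on :: "'i set \<Rightarrow> ('i \<times> 'i) set \<Rightarrow> bool" where
  "directed_on I r \<longleftrightarrow> I \<noteq> {} \<and> preorder_on I r \<and>
     (\<forall>i\<in>I. \<forall>j\<in>I. \<exists>k\<in>I. (i, k) \<in> r \<and> (j, k) \<in> r)"

text \<open>A net is a function on a directed set; it converges to \<open>l\<close> iff it tends to \<open>l\<close> along the
  filter generated by the tails \<open>r `` {i}\<close>.\<close>

definition net_filter :: "'i set \<Rightarrow> ('i \<times> 'i) set \<Rightarrow> 'i filter" where
  "net_filter I r = (INF i\<in>I. principal (r `` {i}))"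

lemma eventually_net_filter:
  assumes "directed_on I r"
  shows "eventually P (net_filter I r) \<longleftrightarrow> (\<exists>i\<in>I. \<forall>j. (i, j) \<in> r \<longrightarrow> P j)"
proof -
  have tr: "trans r" and ne: "I \<noteq> {}"
    using assms by (auto simp: directed_on_def preorder_on_def)
  have "eventually P (net_filter I r) \<longleftrightarrow> (\<exists>i\<in>I. eventually P (principal (r `` {i})))"
    unfolding net_filter_def
  proof (rule eventually_INF_base[OF ne])
    fix i j assume "i \<in> I" "j \<in> I"
    then obtain k where "k \<in> I" "(i, k) \<in> r" "(j, k) \<in> r"
      using assms unfolding directed_on_def by blast
    then show "\<exists>x\<in>I. principal (r `` {x}) \<le> inf (principal (r `` {i})) (principal (r `` {j}))"
      using tr by (intro bexI[of _ k]) (auto dest: transD)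
  qed
  then show ?thesis by (auto simp: eventually_principal)
qed

section \<open>Right amenability\<close>

definition right_folner_net ::
  "('s, 'm) monoid_scheme \<Rightarrow> 'i set \<Rightarrow> ('i \<times> 'i) set \<Rightarrow> ('i \<Rightarrow> 's set) \<Rightarrow> bool" where
  "right_folner_net S I r F \<longleftrightarrow> directed_on I r \<and>
     (\<forall>i\<in>I. finite (F i) \<and> F i \<noteq> {} \<and> F i \<subseteq> carrier S) \<and>
     (\<forall>s\<in>carrier S.
        ((\<lambda>i. real (card ((F i #>\<^bsub>S\<^esub> s) - F i)) / real (card (F i))) \<longlongrightarrow> 0) (net_filter I r))"

text \<open>A definition cannot quantify over all types of indices. The index type below loses nothing:
  every net of subsets of \<open>S\<close>, over an arbitrary index type, has the same tail filter as one
  indexed by pairs \<open>(A, \<T>)\<close> of a member \<open>A\<close> and the set \<open>\<T>\<close> of all members of a tail containing it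
  (\<open>net_reindex\<close>). Consequently amenability (\<open>right_amenableI\<close>) and the limit defining the entropy
  (\<open>tendsto_all_right_folner_nets\<close>) do not depend on this choice.\<close>

type_synonym 's net_index = "'s set \<times> 's set set"

definition right_amenable :: "('s, 'm) monoid_scheme \<Rightarrow> bool" where
  "right_amenable S \<longleftrightarrow>
     (\<exists>(I :: 's net_index set) r F. right_folner_net S I r F)"

lemma net_reindex:
  fixes F :: "'i \<Rightarrow> 's set"
  assumes dir: "directed_on I r"
  obtains J :: "'s net_index set" and r'
  where "directed_on J r'" "fst ` J \<subseteq> F ` I"
    "filtermap fst (net_filter J r') = filtermap F (net_filter I r)"
proof
  define J where "J = {(A, T). A \<in> T \<and> (\<exists>i\<in>I. T = F ` (r `` {i}))}"
  define r' where "r' = {(p, q). p \<in> J \<and> q \<in> J \<and> snd q \<subseteq> snd p}"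
  have tr: "trans r" and ne: "I \<noteq> {}" and sub: "r \<subseteq> I \<times> I" and rf: "\<And>i. i \<in> I \<Longrightarrow> (i, i) \<in> r"
    using dir unfolding directed_on_def preorder_on_def refl_on_def by blast+
  have inJ: "(F i, F ` (r `` {i})) \<in> J" if "i \<in> I" for i
    using that rf[OF that] by (auto simp: J_def)
  have mono: "F ` (r `` {k}) \<subseteq> F ` (r `` {i})" if "(i, k) \<in> r" for i k
    using that tr by (auto dest: transD)
  show dJ: "directed_on J r'"
    unfolding directed_on_def
  proof (intro conjI ballI)
    show "J \<noteq> {}" using ne inJ by blast
    show "preorder_on J r'"
      by (auto simp: preorder_on_def refl_on_def r'_def intro!: transI)
    fix p q assume p: "p \<in> J" and q: "q \<in> J"
    then obtain i j where i: "i \<in> I" "snd p = F ` (r `` {i})"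
      and j: "j \<in> I" "snd q = F ` (r `` {j})"
      by (auto simp: J_def)
    then obtain k where k: "k \<in> I" "(i, k) \<in> r" "(j, k) \<in> r"
      using dir unfolding directed_on_def by blast
    show "\<exists>u\<in>J. (p, u) \<in> r' \<and> (q, u) \<in> r'"
      using p q i j inJ[OF k(1)] mono[OF k(2)] mono[OF k(3)]
      by (intro bexI[OF _ inJ[OF k(1)]]) (simp add: r'_def)
  qed
  show "fst ` J \<subseteq> F ` I"
    using sub by (auto simp: J_def)
  show "filtermap fst (net_filter J r') = filtermap F (net_filter I r)"
  proof (rule filter_eq_iff[THEN iffD2], rule allI)
    fix P
    have "(\<exists>p\<in>J. \<forall>q. (p, q) \<in> r' \<longrightarrow> P (fst q)) \<longleftrightarrow> (\<exists>i\<in>I. \<forall>j. (i, j) \<in> r \<longrightarrow> P (F j))"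
    proof
      assume "\<exists>p\<in>J. \<forall>q. (p, q) \<in> r' \<longrightarrow> P (fst q)"
      then obtain p where p: "p \<in> J" and P: "\<And>q. (p, q) \<in> r' \<Longrightarrow> P (fst q)" by blast
      obtain i where i: "i \<in> I" "snd p = F ` (r `` {i})" using p by (auto simp: J_def)
      have "P (F j)" if "(i, j) \<in> r" for j
      proof -
        have "j \<in> I" using that sub by auto
        from P[of "(F j, F ` (r `` {j}))"] show ?thesis
          using p inJ[OF \<open>j \<in> I\<close>] mono[OF that] i(2) by (simp add: r'_def)
      qed
      then show "\<exists>i\<in>I. \<forall>j. (i, j) \<in> r \<longrightarrow> P (F j)" using i(1) by blast
    next
      assume "\<exists>i\<in>I. \<forall>j. (i, j) \<in> r \<longrightarrow> P (F j)"
      then obtain i where i: "i \<in> I" and P: "\<And>j. (i, j) \<in> r \<Longrightarrow> P (F j)" by blast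
      have "P (fst q)" if "((F i, F ` (r `` {i})), q) \<in> r'" for q
      proof -
        have "fst q \<in> F ` (r `` {i})" using that by (auto simp: r'_def J_def)
        then show ?thesis using P by auto
      qed
      then show "\<exists>p\<in>J. \<forall>q. (p, q) \<in> r' \<longrightarrow> P (fst q)" using inJ[OF i] by blast
    qed
    then show "eventually P (filtermap fst (net_filter J r')) \<longleftrightarrow>
        eventually P (filtermap F (net_filter I r))"
      by (simp add: eventually_filtermap eventually_net_filter dJ dir)
  qed
qed

lemma right_folner_net_reindex:
  fixes F :: "'i \<Rightarrow> 's set"
  assumes "right_folner_net S I r F"
  obtains J :: "'s net_index set" and r'
  where "right_folner_net S J r' fst"
    "filtermap fst (net_filter J r') = filtermap F (net_filter I r)"
proof -
  have "directed_on I r" using assms by (simp add: right_folner_net_def)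
  then obtain J :: "'s net_index set" and r' where J: "directed_on J r'" "fst ` J \<subseteq> F ` I"
    "filtermap fst (net_filter J r') = filtermap F (net_filter I r)"
    by (rule net_reindex)
  have "filterlim (\<lambda>i. f (fst i)) G (net_filter J r') \<longleftrightarrow> filterlim (\<lambda>i. f (F i)) G (net_filter I r)"
    for f :: "'s set \<Rightarrow> real" and G
    using J(3) filterlim_filtermap[of f G fst "net_filter J r'"]
      filterlim_filtermap[of f G F "net_filter I r"] by simp
  note lim = this[of "\<lambda>A. real (card ((A #>\<^bsub>S\<^esub> s) - A)) / real (card A)" for s]
  have "right_folner_net S J r' fst"
    unfolding right_folner_net_def
  proof (intro conjI ballI)
    show "directed_on J r'" by (rule J(1))
    fix p assume "p \<in> J"
    then obtain i where "i \<in> I" "fst p = F i" using J(2) by auto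
    then show "finite (fst p)" "fst p \<noteq> {}" "fst p \<subseteq> carrier S"
      using assms by (auto simp: right_folner_net_def)
  next
    fix s assume "s \<in> carrier S"
    then show "((\<lambda>i. real (card ((fst i #>\<^bsub>S\<^esub> s) - fst i)) / real (card (fst i))) \<longlongrightarrow> 0)
        (net_filter J r')"
      using assms lim[of s] by (simp add: right_folner_net_def)
  qed
  then show thesis using that J(3) by blast
qed

lemma right_amenableI: "right_folner_net S I r F \<Longrightarrow> right_amenable S"
  unfolding right_amenable_def by (metis right_folner_net_reindex)

lemma tendsto_all_right_folner_nets:
  fixes f :: "'s set \<Rightarrow> real"
  assumes "\<And>(J :: 's net_index set) r' G. right_folner_net S J r' G \<Longrightarrow>
      ((\<lambda>j. f (G j)) \<longlongrightarrow> L) (net_filter J r')"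
    and "right_folner_net S I r F"
  shows "((\<lambda>i. f (F i)) \<longlongrightarrow> L) (net_filter I r)"
proof -
  obtain J :: "'s net_index set" and r' where J: "right_folner_net S J r' fst"
    "filtermap fst (net_filter J r') = filtermap F (net_filter I r)"
    using assms(2) by (rule right_folner_net_reindex)
  have "filterlim f (nhds L) (filtermap F (net_filter I r))"
    using assms(1)[OF J(1)] unfolding J(2)[symmetric] filterlim_filtermap .
  then show ?thesis unfolding filterlim_filtermap .
qed

section \<open>Actions\<close>

text \<open>Abelian groups are written multiplicatively, as in \<open>HOL-Algebra\<close>: \<open>\<one>\<close>, \<open>\<otimes>\<close> and \<open>\<Otimes>\<close>
  stand for \<open>0\<close>, \<open>+\<close> and \<open>\<Sum>\<close>.\<close>

definition left_action ::
  "('s, 'm) monoid_scheme \<Rightarrow> ('x, 'n) monoid_scheme \<Rightarrow> ('s \<Rightarrow> 'x \<Rightarrow> 'x) \<Rightarrow> bool" where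
  "left_action S A lam \<longleftrightarrow>
     (\<forall>s\<in>carrier S. lam s \<in> hom A A) \<and>
     (\<forall>x\<in>carrier A. lam \<one>\<^bsub>S\<^esub> x = x) \<and>
     (\<forall>s\<in>carrier S. \<forall>t\<in>carrier S. \<forall>x\<in>carrier A. lam (s \<otimes>\<^bsub>S\<^esub> t) x = lam s (lam t x))"

definition action_kernel ::
  "('s, 'm) monoid_scheme \<Rightarrow> ('x, 'n) monoid_scheme \<Rightarrow> ('s \<Rightarrow> 'x \<Rightarrow> 'x) \<Rightarrow> 'x set" where
  "action_kernel S A lam = (\<Union>s\<in>carrier S. kernel A A (lam s))"

text \<open>The induced map on cosets of a subgroup \<open>K\<close>, that is, \<open>x + K \<mapsto> lam s x + K\<close>
  (see \<open>induced_action_coset\<close>).\<close>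

definition induced_action ::
  "('x, 'n) monoid_scheme \<Rightarrow> 'x set \<Rightarrow> ('s \<Rightarrow> 'x \<Rightarrow> 'x) \<Rightarrow> 's \<Rightarrow> 'x set \<Rightarrow> 'x set" where
  "induced_action A K lam s C = the_elem ((\<lambda>x. K #>\<^bsub>A\<^esub> lam s x) ` C)"

lemma induced_action_coset:
  assumes "comm_group A" "subgroup K A" "lam s \<in> hom A A" "lam s ` K \<subseteq> K" "x \<in> carrier A"
  shows "induced_action A K lam s (K #>\<^bsub>A\<^esub> x) = K #>\<^bsub>A\<^esub> lam s x"
proof -
  interpret AG: comm_group A by fact
  have K: "K \<subseteq> carrier A" using assms(2) by (rule subgroup.subset)
  have "K #>\<^bsub>A\<^esub> lam s y = K #>\<^bsub>A\<^esub> lam s x" if y: "y \<in> K #>\<^bsub>A\<^esub> x" for y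
  proof -
    obtain k where k: "k \<in> K" "y = k \<otimes>\<^bsub>A\<^esub> x" using y by (auto simp: r_coset_def)
    have kx: "lam s k \<in> K" "lam s x \<in> carrier A"
      using assms(4) k(1) hom_in_carrier[OF assms(3,5)] by blast+
    have "lam s y = lam s k \<otimes>\<^bsub>A\<^esub> lam s x"
      using k(2) hom_mult[OF assms(3) subsetD[OF K k(1)] assms(5)] by simp
    then have "lam s y \<in> K #>\<^bsub>A\<^esub> lam s x" using kx(1) unfolding r_coset_def by blast
    from AG.repr_independence[OF this kx(2) assms(2)] show ?thesis by simp
  qed
  moreover have "x \<in> K #>\<^bsub>A\<^esub> x" using assms(2,5) by (rule AG.rcos_self[rotated])
  ultimately show ?thesis
    unfolding induced_action_def by (intro the_elem_image_unique) blast+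
qed

section \<open>Algebraic entropy\<close>

definition trajectory ::
  "('x, 'n) monoid_scheme \<Rightarrow> ('s \<Rightarrow> 'x \<Rightarrow> 'x) \<Rightarrow> 's set \<Rightarrow> 'x set \<Rightarrow> 'x set" where
  "trajectory A lam F E = {(\<Otimes>\<^bsub>A\<^esub>s\<in>F. y s) | y. y \<in> (\<Pi> s\<in>F. lam s ` E)}"

text \<open>The common limit along all right Folner nets of \<open>S\<close>.\<close>

definition H_alg ::
  "('s, 'm) monoid_scheme \<Rightarrow> ('x, 'n) monoid_scheme \<Rightarrow> ('s \<Rightarrow> 'x \<Rightarrow> 'x) \<Rightarrow> 'x set \<Rightarrow> real" where
  "H_alg S A lam E = (THE L. \<forall>(I :: 's net_index set) r F. right_folner_net S I r F \<longrightarrow>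
     ((\<lambda>i. ln (real (card (trajectory A lam (F i) E))) / real (card (F i))) \<longlongrightarrow> L)
       (net_filter I r))"

definition h_alg ::
  "('s, 'm) monoid_scheme \<Rightarrow> ('x, 'n) monoid_scheme \<Rightarrow> ('s \<Rightarrow> 'x \<Rightarrow> 'x) \<Rightarrow> ereal" where
  "h_alg S A lam =
     (SUP E \<in> {E. finite E \<and> E \<subseteq> carrier A \<and> \<one>\<^bsub>A\<^esub> \<in> E}. ereal (H_alg S A lam E))"

end

theory Submission
  imports Defs
begin

text \<open>For a finite \<open>F\<close> write \<open>f F\<close> for the logarithm of the size of the trajectory. Shearer's
  inequality for Shannon entropy makes \<open>f\<close> fractionally subadditive. Covering a Folner set \<open>F\<close> by
  the translates \<open>c K\<close> with \<open>c \<in> F\<close> therefore bounds \<open>f F / card F\<close> by \<open>f K / card K\<close> up to a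
  vanishing error, so the limit along every right Folner net exists and equals the infimum of
  \<open>f K / card K\<close>; no quasi-tilings are needed. A finite trajectory along \<open>F\<close> is collapsed by
  some \<open>lam s\<close> exactly as by the quotient map (left Ore condition), and its image under \<open>lam s\<close> is
  the trajectory along \<open>s F\<close>. As \<open>card (s F) = card F\<close>, the two infima agree.\<close>

section \<open>Entropy of a labelling and Shearer's inequality\<close>

definition fibre :: "'v set \<Rightarrow> ('v \<Rightarrow> 'l) \<Rightarrow> 'v \<Rightarrow> 'v set" where
  "fibre V p v = {w \<in> V. p w = p v}"

text \<open>\<open>card V\<close> times the Shannon entropy of the label \<open>p v\<close> of a uniformly random \<open>v \<in> V\<close>.\<close>

definition label_entropy :: "'v set \<Rightarrow> ('v \<Rightarrow> 'l) \<Rightarrow> real" where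
  "label_entropy V p = (\<Sum>v\<in>V. ln (real (card V) / real (card (fibre V p v))))"

lemma finite_fibre: "finite V \<Longrightarrow> finite (fibre V p v)"
  by (simp add: fibre_def)

lemma card_fibre_pos: "finite V \<Longrightarrow> v \<in> V \<Longrightarrow> 0 < card (fibre V p v)"
  by (auto simp: fibre_def card_gt_0_iff)

lemma fibre_cong: "p v = p w \<Longrightarrow> fibre V p v = fibre V p w"
  by (simp add: fibre_def)

text \<open>Each fibre contributes total weight 1, so the sum counts the labels that occur.\<close>

lemma sum_inverse_card_fibre:
  assumes "finite V"
  shows "(\<Sum>v\<in>V. 1 / real (card (fibre V p v))) = real (card (p ` V))"
proof -
  have "(\<Sum>v\<in>V. 1 / real (card (fibre V p v)))
      = (\<Sum>y\<in>p ` V. \<Sum>v\<in>{x\<in>V. p x = y}. 1 / real (card (fibre V p v)))"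
    by (rule sum.image_gen[OF assms])
  also have "\<dots> = (\<Sum>y\<in>p ` V. 1)"
  proof (rule sum.cong[OF refl])
    fix y assume "y \<in> p ` V"
    then obtain w where w: "w \<in> V" "y = p w" by blast
    have "(\<Sum>v\<in>{x\<in>V. p x = y}. 1 / real (card (fibre V p v)))
        = (\<Sum>v\<in>fibre V p w. 1 / real (card (fibre V p w)))"
      by (rule sum.cong) (auto simp: w(2) fibre_def)
    also have "\<dots> = 1" using card_fibre_pos[OF assms w(1), of p] by simp
    finally show "(\<Sum>v\<in>{x\<in>V. p x = y}. 1 / real (card (fibre V p v))) = 1" .
  qed
  also have "\<dots> = real (card (p ` V))" by simp
  finally show ?thesis .
qed

text \<open>Apply \<open>ln x \<le> x - 1\<close> to \<open>x = n / (c * m)\<close>, with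
  \<open>n\<close> points, \<open>m\<close> labels and fibre size \<open>c\<close>. The bounds add
  up to 0 because the reciprocals \<open>1 / c\<close> add up to \<open>m\<close>.\<close>

lemma label_entropy_le:
  assumes "finite V"
  shows "label_entropy V p \<le> real (card V) * ln (real (card (p ` V)))"
proof (cases "V = {}")
  case True
  then show ?thesis by (simp add: label_entropy_def)
next
  case False
  let ?n = "real (card V)" and ?m = "real (card (p ` V))"
  have n: "?n > 0" and m: "?m > 0" using False assms by (auto simp: card_gt_0_iff)
  have "label_entropy V p - ?n * ln ?m
      = (\<Sum>v\<in>V. ln (?n / real (card (fibre V p v))) - ln ?m)"
    by (simp add: label_entropy_def sum_subtractf)
  also have "\<dots> \<le> (\<Sum>v\<in>V. ?n / ?m * (1 / real (card (fibre V p v))) - 1)"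
  proof (rule sum_mono)
    fix v assume "v \<in> V"
    then have c: "real (card (fibre V p v)) > 0" using card_fibre_pos[OF assms] by simp
    then have "ln (?n / real (card (fibre V p v))) - ln ?m
        = ln (?n / real (card (fibre V p v)) / ?m)"
      using n m by (subst ln_div) auto
    also have "\<dots> \<le> ?n / real (card (fibre V p v)) / ?m - 1"
      using n m c by (intro ln_le_minus_one) simp
    finally show "ln (?n / real (card (fibre V p v))) - ln ?m
        \<le> ?n / ?m * (1 / real (card (fibre V p v))) - 1"
      by (simp add: field_simps)
  qed
  also have "\<dots> = ?n / ?m * ?m - ?n"
    by (simp only: sum_subtractf sum_distrib_left[symmetric] sum_inverse_card_fibre[OF assms]) simp
  also have "\<dots> = 0" using m by simp
  finally show ?thesis by simp
qed

lemma label_entropy_inj_on: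
  assumes "inj_on p V"
  shows "label_entropy V p = real (card V) * ln (real (card V))"
proof -
  have "fibre V p v = {v}" if "v \<in> V" for v
    using assms that by (auto simp: fibre_def dest: inj_onD)
  then show ?thesis by (simp add: label_entropy_def)
qed

lemma label_entropy_const:
  assumes "\<And>v w. v \<in> V \<Longrightarrow> w \<in> V \<Longrightarrow> p v = p w"
  shows "label_entropy V p = 0"
proof -
  have "fibre V p v = V" if "v \<in> V" for v
    using assms that unfolding fibre_def by blast
  then show ?thesis by (simp add: label_entropy_def)
qed

text \<open>The labelling \<open>q\<close> refines \<open>p\<close> on \<open>V\<close>, so its
  fibres are contained in those of \<open>p\<close>.\<close>

lemma label_entropy_mono:
  assumes "finite V" and "\<And>v w. v \<in> V \<Longrightarrow> w \<in> V \<Longrightarrow> q v = q w \<Longrightarrow> p v = p w"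
  shows "label_entropy V p \<le> label_entropy V q"
  unfolding label_entropy_def
proof (rule sum_mono)
  fix v assume v: "v \<in> V"
  have "fibre V q v \<subseteq> fibre V p v" using assms(2) v unfolding fibre_def by blast
  then have "card (fibre V q v) \<le> card (fibre V p v)"
    using finite_fibre[OF assms(1)] by (rule card_mono[rotated])
  moreover have "0 < card (fibre V q v)" "0 < card (fibre V p v)" "0 < card V"
    using card_fibre_pos[OF assms(1) v] v assms(1) by (auto simp: card_gt_0_iff)
  ultimately show "ln (real (card V) / real (card (fibre V p v)))
      \<le> ln (real (card V) / real (card (fibre V q v)))"
    by (simp add: frac_le)
qed

text \<open>The sum of the likelihood ratios that have to be at most \<open>card V\<close> for submodularity: it is
  expanded into triples \<open>(v, a, b)\<close> with \<open>a\<close> and \<open>b\<close> in the \<open>p\<close>- and \<open>q\<close>-fibre of \<open>v\<close>, and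
  summed over \<open>v\<close> first.\<close>

lemma sum_fibre_ratio_le:
  assumes fin: "finite V"
    and j: "\<And>v w. v \<in> V \<Longrightarrow> w \<in> V \<Longrightarrow> j v = j w \<longleftrightarrow> p v = p w \<and> q v = q w"
    and r: "\<And>v w. v \<in> V \<Longrightarrow> w \<in> V \<Longrightarrow> p v = p w \<or> q v = q w \<Longrightarrow> r v = r w"
  shows "(\<Sum>v\<in>V. real (card (fibre V p v)) * real (card (fibre V q v))
      / (real (card (fibre V j v)) * real (card (fibre V r v)))) \<le> real (card V)"
proof -
  let ?N = "\<lambda>v. real (card (fibre V j v)) * real (card (fibre V r v))"
  \<comment> \<open>The same count is stated once for each label type, since type variables are
    fixed inside a proof.\<close>
  have ind: "real (card (fibre V p v)) = (\<Sum>a\<in>V. of_bool (p a = p v))" for p :: "'a \<Rightarrow> 'c" and v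
    using fin by (simp add: fibre_def Int_def of_bool_def sum.If_cases)
  have ind': "real (card (fibre V p v)) = (\<Sum>a\<in>V. of_bool (p a = p v))" for p :: "'a \<Rightarrow> 'd" and v
    using fin by (simp add: fibre_def Int_def of_bool_def sum.If_cases)
  have "(\<Sum>v\<in>V. real (card (fibre V p v)) * real (card (fibre V q v)) / ?N v)
      = (\<Sum>v\<in>V. \<Sum>a\<in>V. \<Sum>b\<in>V. of_bool (p a = p v) * of_bool (q b = q v) / ?N v)"
    by (simp only: ind[of p] ind'[of q] sum_product sum_divide_distrib)
  also have "\<dots> = (\<Sum>a\<in>V. \<Sum>b\<in>V. \<Sum>v\<in>V. of_bool (p a = p v) * of_bool (q b = q v) / ?N v)"
    by (subst sum.swap) (intro sum.cong[OF refl] sum.swap)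
  also have "\<dots> \<le> (\<Sum>a\<in>V. \<Sum>b\<in>V. of_bool (r b = r a) / real (card (fibre V r a)))"
  proof (intro sum_mono)
    fix a b assume a: "a \<in> V" and b: "b \<in> V"
    let ?W = "{v \<in> V. p a = p v \<and> q b = q v}"
    have eq: "(\<Sum>v\<in>V. of_bool (p a = p v) * of_bool (q b = q v) / ?N v) = (\<Sum>v\<in>?W. 1 / ?N v)"
      using fin by (intro sum.mono_neutral_cong_right) auto
    show "(\<Sum>v\<in>V. of_bool (p a = p v) * of_bool (q b = q v) / ?N v)
        \<le> of_bool (r b = r a) / real (card (fibre V r a))"
    proof (cases "?W = {}")
      case True
      then show ?thesis unfolding eq by (simp only: True) simp
    next
      case False
      \<comment> \<open>Any \<open>u\<close> matching \<open>a\<close> under \<open>p\<close> and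
        \<open>b\<close> under \<open>q\<close> makes \<open>?W\<close> its entire
        \<open>j\<close>-fibre, where the summand is constant. The \<open>r\<close>-labels of
        \<open>a\<close>, \<open>u\<close> and \<open>b\<close> coincide, so the right-hand side is
        nonzero.\<close>
      then obtain u where u: "u \<in> V" "p a = p u" "q b = q u" by blast
      have W: "?W = fibre V j u" using u j[OF _ u(1)] by (auto simp: fibre_def)
      have "r u = r a" "r u = r b" using r u a b by metis+
      moreover have "(\<Sum>v\<in>?W. 1 / ?N v) = (\<Sum>v\<in>fibre V j u. 1 / ?N u)"
      proof (unfold W, rule sum.cong[OF refl])
        fix v assume "v \<in> fibre V j u"
        then have v: "v \<in> V" "j v = j u" by (auto simp: fibre_def)
        then have "r v = r u" using j r u(1) by metis
        then show "1 / ?N v = 1 / ?N u" using v(2) fibre_cong[of j v u V] fibre_cong[of r v u V] by simp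
      qed
      moreover have "\<dots> = 1 / real (card (fibre V r u))"
        using card_fibre_pos[OF fin u(1), of j] by simp
      moreover have "fibre V r u = fibre V r a" using \<open>r u = r a\<close> by (rule fibre_cong)
      ultimately show ?thesis unfolding eq by simp
    qed
  qed
  also have "\<dots> = (\<Sum>a\<in>V. 1)"
  proof (rule sum.cong[OF refl])
    fix a assume "a \<in> V"
    have "(\<Sum>b\<in>V. of_bool (r b = r a)) = real (card (fibre V r a))"
      using fin by (simp add: fibre_def Int_def of_bool_def sum.If_cases)
    then show "(\<Sum>b\<in>V. of_bool (r b = r a) / real (card (fibre V r a))) = 1"
      using card_fibre_pos[OF fin \<open>a \<in> V\<close>, of r] by (simp flip: sum_divide_distrib)
  qed
  finally show ?thesis by simp
qed

text \<open>This is nonnegativity of the mutual information of \<open>p\<close> and \<open>q\<close>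
  conditioned on \<open>r\<close>: here \<open>j\<close> is the joint label, and \<open>r\<close> is
  determined by \<open>p\<close> and also by \<open>q\<close>. The inequality
  \<open>ln x \<le> x - 1\<close> reduces it to the bound on likelihood ratios.\<close>

lemma label_entropy_submodular:
  assumes fin: "finite V"
    and j: "\<And>v w. v \<in> V \<Longrightarrow> w \<in> V \<Longrightarrow> j v = j w \<longleftrightarrow> p v = p w \<and> q v = q w"
    and r: "\<And>v w. v \<in> V \<Longrightarrow> w \<in> V \<Longrightarrow> p v = p w \<or> q v = q w \<Longrightarrow> r v = r w"
  shows "label_entropy V j + label_entropy V r \<le> label_entropy V p + label_entropy V q"
proof -
  let ?n = "real (card V)"
  let ?p = "\<lambda>v. real (card (fibre V p v))" and ?q = "\<lambda>v. real (card (fibre V q v))"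
  let ?j = "\<lambda>v. real (card (fibre V j v))" and ?r = "\<lambda>v. real (card (fibre V r v))"
  have "label_entropy V j + label_entropy V r - (label_entropy V p + label_entropy V q)
      = (\<Sum>v\<in>V. ln (?n / ?j v) + ln (?n / ?r v) - (ln (?n / ?p v) + ln (?n / ?q v)))"
    by (simp add: label_entropy_def sum_subtractf sum.distrib)
  also have "\<dots> \<le> (\<Sum>v\<in>V. ?p v * ?q v / (?j v * ?r v) - 1)"
  proof (rule sum_mono)
    fix v assume v: "v \<in> V"
    then have pos: "?p v > 0" "?q v > 0" "?j v > 0" "?r v > 0" "?n > 0"
      using card_fibre_pos[OF fin v, of p] card_fibre_pos[OF fin v, of q]
        card_fibre_pos[OF fin v, of j] card_fibre_pos[OF fin v, of r] fin
      by (simp_all del: card_gt_0_iff) (metis card_gt_0_iff empty_iff)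
    then have "ln (?n / ?j v) + ln (?n / ?r v) - (ln (?n / ?p v) + ln (?n / ?q v))
        = ln (?p v * ?q v / (?j v * ?r v))"
      by (simp add: ln_div ln_mult)
    also have "\<dots> \<le> ?p v * ?q v / (?j v * ?r v) - 1"
      using pos by (intro ln_le_minus_one) simp
    finally show "ln (?n / ?j v) + ln (?n / ?r v) - (ln (?n / ?p v) + ln (?n / ?q v))
        \<le> ?p v * ?q v / (?j v * ?r v) - 1" .
  qed
  also have "\<dots> \<le> 0"
    using sum_fibre_ratio_le[of V j p q r, OF fin j r] by (simp add: sum_subtractf)
  finally show ?thesis by simp
qed

lemma restrict_eq_iff: "restrict f B = restrict g B \<longleftrightarrow> (\<forall>x\<in>B. f x = g x)"
  by (auto simp: restrict_def fun_eq_iff)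

text \<open>Induction on \<open>G\<close>. By submodularity a new coordinate \<open>g\<close> adds
  at least as much entropy to the coordinates in \<open>B c \<inter> G\<close> as to all of
  \<open>G\<close>, and at least \<open>d\<close> of the sets \<open>B c\<close> contain
  \<open>g\<close>.\<close>

lemma shearer_label_entropy:
  fixes V :: "('i \<Rightarrow> 'a) set"
  assumes "finite V" "finite C" "finite G"
    and "\<And>g. g \<in> G \<Longrightarrow> d \<le> card {c \<in> C. g \<in> B c}"
  shows "real d * label_entropy V (\<lambda>v. restrict v G)
      \<le> (\<Sum>c\<in>C. label_entropy V (\<lambda>v. restrict v (B c \<inter> G)))"
  using assms(3,4)
proof (induction G)
  case empty
  then show ?case by (simp add: label_entropy_const)
next
  case (insert g G)
  let ?h = "\<lambda>M. label_entropy V (\<lambda>v. restrict v M)"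
  let ?D = "{c \<in> C. g \<in> B c}"
  let ?\<delta> = "?h (insert g G) - ?h G"
  have "?\<delta> \<ge> 0"
    using label_entropy_mono[OF assms(1), of "\<lambda>v. restrict v (insert g G)" "\<lambda>v. restrict v G"]
    by (simp add: restrict_eq_iff)
  then have "real d * ?\<delta> \<le> real (card ?D) * ?\<delta>"
    using insert.prems[of g] by (intro mult_right_mono) auto
  also have "\<dots> = (\<Sum>c\<in>C. if g \<in> B c then ?\<delta> else 0)"
    using assms(2) by (simp add: sum.If_cases Int_def)
  also have "\<dots> \<le> (\<Sum>c\<in>C. ?h (B c \<inter> insert g G) - ?h (B c \<inter> G))"
  proof (rule sum_mono)
    fix c
    \<comment> \<open>The labels on \<open>insert g (B c \<inter> G)\<close> and on \<open>G\<close>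
      together amount to the label on \<open>insert g G\<close>; their common part is the label on
      \<open>B c \<inter> G\<close>.\<close>
    have "?h (insert g G) + ?h (B c \<inter> G) \<le> ?h (insert g (B c \<inter> G)) + ?h G"
      by (rule label_entropy_submodular[OF assms(1)]) (auto simp: restrict_eq_iff)
    then have "?\<delta> \<le> ?h (insert g (B c \<inter> G)) - ?h (B c \<inter> G)" by simp
    then show "(if g \<in> B c then ?\<delta> else 0) \<le> ?h (B c \<inter> insert g G) - ?h (B c \<inter> G)"
      by (auto simp: Int_insert_right)
  qed
  also have "\<dots> = (\<Sum>c\<in>C. ?h (B c \<inter> insert g G)) - (\<Sum>c\<in>C. ?h (B c \<inter> G))"
    by (rule sum_subtractf)
  moreover have "real d * ?h G \<le> (\<Sum>c\<in>C. ?h (B c \<inter> G))"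
    using insert.IH insert.prems by blast
  ultimately show ?case
    unfolding right_diff_distrib by linarith
qed

section \<open>Fractional subadditivity of the size of sumsets\<close>

text \<open>Extensional families form a finite set whenever \<open>B\<close> and all
  \<open>Y s\<close> are finite, and they are determined by their restrictions. The link to the
  plain function space in \<open>trajectory\<close> is \<open>sumset_eq_Pi\<close>.\<close>

definition sumset :: "('x, 'n) monoid_scheme \<Rightarrow> ('i \<Rightarrow> 'x set) \<Rightarrow> 'i set \<Rightarrow> 'x set" where
  "sumset A Y B = (\<lambda>y. \<Otimes>\<^bsub>A\<^esub>s\<in>B. y s) ` (\<Pi>\<^sub>E s\<in>B. Y s)"

lemma sumset_eq_Pi:
  assumes "comm_group A" and Y: "\<forall>s\<in>F. Y s \<subseteq> carrier A"
  shows "sumset A Y F = (\<lambda>y. \<Otimes>\<^bsub>A\<^esub>s\<in>F. y s) ` (\<Pi> s\<in>F. Y s)"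
proof -
  interpret comm_group A by fact
  have "(\<Otimes>\<^bsub>A\<^esub>s\<in>F. y s) \<in> sumset A Y F" if y: "y \<in> (\<Pi> s\<in>F. Y s)" for y
  proof -
    have "y \<in> F \<rightarrow> carrier A" using y Y by fastforce
    then have "(\<Otimes>\<^bsub>A\<^esub>s\<in>F. restrict y F s) = (\<Otimes>\<^bsub>A\<^esub>s\<in>F. y s)"
      by (intro finprod_cong') auto
    moreover have "restrict y F \<in> (\<Pi>\<^sub>E s\<in>F. Y s)" using y by auto
    ultimately show ?thesis unfolding sumset_def by (metis image_eqI)
  qed
  then show ?thesis unfolding sumset_def PiE_def by blast
qed

text \<open>Each element of the sumset is represented by the family of least weight, where the weight is
  additive in the index and separates families on every index set. Exchanging a part of a
  representing family shows that its parts represent their sums with least weight too, so the sum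
  over \<open>B\<close> determines the restriction to \<open>B\<close>.\<close>

lemma sumset_representatives:
  assumes "comm_group A" and fG: "finite G"
    and Y: "\<forall>s\<in>G. finite (Y s) \<and> Y s \<subseteq> carrier A"
  obtains V where "V \<subseteq> (\<Pi>\<^sub>E s\<in>G. Y s)" "card V = card (sumset A Y G)"
    "\<forall>B\<subseteq>G. card ((\<lambda>v. restrict v B) ` V) \<le> card (sumset A Y B)"
proof -
  interpret comm_group A by fact
  let ?P = "\<Pi>\<^sub>E s\<in>G. Y s"
  let ?pr = "\<lambda>B y. \<Otimes>\<^bsub>A\<^esub>s\<in>B. y s"
  have "finite (Sigma G Y)" using fG Y by auto
  from finite_imp_inj_to_nat_seg[OF this]
  obtain e :: "_ \<Rightarrow> nat" where e: "inj_on e (Sigma G Y)" by metis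
  \<comment> \<open>With distinct codes \<open>e\<close> for the pairs \<open>(s, y s)\<close>, the
    sum of the powers of two is the binary encoding of a finite set of codes and hence determines
    the family on \<open>B\<close>.\<close>
  define W where "W B y = (\<Sum>s\<in>B. (2::nat) ^ e (s, y s))" for B y
  have W_inj: "\<forall>s\<in>B. v s = w s"
    if B: "B \<subseteq> G" and v: "v \<in> ?P" and w: "w \<in> ?P" and eq: "W B v = W B w" for B v w
  proof -
    have enc: "W B y = set_encode (e ` (\<lambda>s. (s, y s)) ` B)" if "y \<in> ?P" for y
    proof -
      have "(\<lambda>s. (s, y s)) ` B \<subseteq> Sigma G Y" using B that by auto
      then have "inj_on e ((\<lambda>s. (s, y s)) ` B)" using e inj_on_subset by blast
      moreover have "inj_on (\<lambda>s. (s, y s)) B" by (simp add: inj_on_def)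
      ultimately show ?thesis
        by (simp add: W_def set_encode_def sum.reindex)
    qed
    have "finite B" using B fG by (rule finite_subset)
    then have "e ` (\<lambda>s. (s, v s)) ` B = e ` (\<lambda>s. (s, w s)) ` B"
      using eq enc v w set_encode_eq by simp
    moreover have "(\<lambda>s. (s, v s)) ` B \<subseteq> Sigma G Y" using B v by auto
    moreover have "(\<lambda>s. (s, w s)) ` B \<subseteq> Sigma G Y" using B w by auto
    ultimately have "(\<lambda>s. (s, v s)) ` B = (\<lambda>s. (s, w s)) ` B"
      by (simp add: inj_on_image_eq_iff[OF e])
    moreover have "(s, v s) \<in> (\<lambda>s. (s, v s)) ` B" if "s \<in> B" for s using that by (rule imageI)
    ultimately show ?thesis by auto
  qed
  define V where "V = {v \<in> ?P. \<forall>z\<in>?P. ?pr G z = ?pr G v \<longrightarrow> W G v \<le> W G z}"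
  have det_le: "W B w \<le> W B v"
    if B: "B \<subseteq> G" and v: "v \<in> V" and w: "w \<in> V" and eq: "?pr B v = ?pr B w" for B v w
  proof -
    \<comment> \<open>The hybrid of \<open>v\<close> on \<open>B\<close> and \<open>w\<close>
      elsewhere has the same total as \<open>w\<close>, so minimality of \<open>w\<close> applies;
      the contributions outside \<open>B\<close> then cancel.\<close>
    define z where "z s = (if s \<in> B then v s else w s)" for s
    have vP: "v \<in> ?P" and wP: "w \<in> ?P" using v w by (auto simp: V_def)
    have zP: "z \<in> ?P" using vP wP B by (auto simp: z_def PiE_iff extensional_def)
    have G: "G = B \<union> (G - B)" and fB: "finite B" "finite (G - B)"
      using B fG finite_subset by auto
    have split: "?pr G y = ?pr B y \<otimes>\<^bsub>A\<^esub> ?pr (G - B) y" if "y \<in> ?P" for y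
    proof -
      have "y \<in> G \<rightarrow> carrier A" using that Y by fastforce
      then show ?thesis using fB B by (subst G, intro finprod_Un_disjoint) auto
    qed
    have splitW: "W G y = W B y + W (G - B) y" for y
      using fG B by (simp add: W_def sum.subset_diff add.commute)
    have car: "v \<in> G \<rightarrow> carrier A" "w \<in> G \<rightarrow> carrier A" using vP wP Y by fastforce+
    have "?pr B z = ?pr B v"
      using car B by (intro finprod_cong') (auto simp: z_def)
    moreover have "?pr (G - B) z = ?pr (G - B) w"
      using car by (intro finprod_cong') (auto simp: z_def)
    ultimately have "?pr G z = ?pr G w"
      using split[OF zP] split[OF wP] eq by simp
    then have "W G w \<le> W G z" using w zP by (simp add: V_def)
    moreover have "W B z = W B v" "W (G - B) z = W (G - B) w"
      by (auto simp: W_def z_def intro!: sum.cong)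
    ultimately show ?thesis using splitW[of w] splitW[of z] by simp
  qed
  have det: "\<forall>s\<in>B. v s = w s"
    if "B \<subseteq> G" "v \<in> V" "w \<in> V" "?pr B v = ?pr B w" for B v w
    using that det_le[of B v w] det_le[of B w v] by (intro W_inj) (auto simp: V_def)
  have VP: "V \<subseteq> ?P" by (auto simp: V_def)
  have "inj_on (?pr G) V"
  proof (rule inj_onI)
    fix v w assume vw: "v \<in> V" "w \<in> V" "?pr G v = ?pr G w"
    then have "\<forall>s\<in>G. v s = w s" by (intro det) auto
    then show "v = w" using vw(1,2) VP by (intro PiE_ext[of v G Y w]) auto
  qed
  moreover have "?pr G ` V = sumset A Y G"
  proof
    show "?pr G ` V \<subseteq> sumset A Y G" using VP by (auto simp: sumset_def)
    show "sumset A Y G \<subseteq> ?pr G ` V"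
    proof
      fix x assume "x \<in> sumset A Y G"
      then obtain y where y: "y \<in> ?P" "x = ?pr G y" by (auto simp: sumset_def)
      then obtain v where "v \<in> ?P \<and> ?pr G v = x"
        "\<And>z. z \<in> ?P \<and> ?pr G z = x \<Longrightarrow> W G v \<le> W G z"
        using ex_has_least_nat[of "\<lambda>z. z \<in> ?P \<and> ?pr G z = x" y "W G"] by auto
      then show "x \<in> ?pr G ` V" by (intro image_eqI[of _ _ v]) (auto simp: V_def)
    qed
  qed
  ultimately have "card V = card (sumset A Y G)" using card_image by metis
  moreover have "card ((\<lambda>v. restrict v B) ` V) \<le> card (sumset A Y B)" if B: "B \<subseteq> G" for B
  proof (rule card_inj_on_le[where f = "?pr B"])
    have pr: "?pr B (restrict v B) = ?pr B v" if "v \<in> V" for v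
    proof (rule finprod_cong')
      show "v \<in> B \<rightarrow> carrier A" using that VP Y B by fastforce
    qed auto
    show "inj_on (?pr B) ((\<lambda>v. restrict v B) ` V)"
      using det[OF B] pr by (intro inj_onI) (auto simp: restrict_eq_iff)
    show "?pr B ` (\<lambda>v. restrict v B) ` V \<subseteq> sumset A Y B"
      using VP B unfolding sumset_def by (intro image_mono) fastforce
    show "finite (sumset A Y B)"
      unfolding sumset_def using B fG Y by (intro finite_imageI finite_PiE) (auto intro: finite_subset)
  qed
  ultimately show thesis using VP that by blast
qed

text \<open>Shearer's inequality for a uniformly random representative: the label on
  \<open>G\<close> is injective and attains the logarithm of the size of the sumset, while a partial
  label takes at most as many values as the smaller sumset has elements. It remains to divide by
  \<open>card V\<close>.\<close>

lemma shearer_sumset: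
  assumes "comm_group A" "finite G"
    and Y: "\<forall>s\<in>G. finite (Y s) \<and> Y s \<noteq> {} \<and> Y s \<subseteq> carrier A"
    and "finite C" and cover: "\<And>g. g \<in> G \<Longrightarrow> d \<le> card {c \<in> C. g \<in> B c}"
  shows "real d * ln (real (card (sumset A Y G)))
      \<le> (\<Sum>c\<in>C. ln (real (card (sumset A Y (B c \<inter> G)))))"
proof -
  have Y': "\<forall>s\<in>G. finite (Y s) \<and> Y s \<subseteq> carrier A" using Y by blast
  obtain V where VP: "V \<subseteq> (\<Pi>\<^sub>E s\<in>G. Y s)" and cV: "card V = card (sumset A Y G)"
    and res: "\<forall>B\<subseteq>G. card ((\<lambda>v. restrict v B) ` V) \<le> card (sumset A Y B)"
    by (rule sumset_representatives[OF assms(1,2) Y'])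
  have "finite (\<Pi>\<^sub>E s\<in>G. Y s)" using assms(2) Y by (intro finite_PiE) auto
  then have fV: "finite V" and "finite (sumset A Y G)"
    using VP finite_subset by (auto simp: sumset_def)
  moreover have "sumset A Y G \<noteq> {}" using Y by (simp add: sumset_def PiE_eq_empty_iff)
  ultimately have pos: "card V > 0" using cV by (simp add: card_gt_0_iff)
  have "inj_on (\<lambda>v. restrict v G) V"
    using VP by (intro inj_onI) (auto simp: restrict_eq_iff intro: PiE_ext)
  then have "real (card V) * (real d * ln (real (card V)))
      = real d * label_entropy V (\<lambda>v. restrict v G)"
    by (simp add: label_entropy_inj_on)
  also have "\<dots> \<le> (\<Sum>c\<in>C. label_entropy V (\<lambda>v. restrict v (B c \<inter> G)))"
    using fV assms(2,4) cover by (intro shearer_label_entropy)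
  also have "\<dots> \<le> (\<Sum>c\<in>C. real (card V) * ln (real (card (sumset A Y (B c \<inter> G)))))"
  proof (rule sum_mono)
    fix c
    let ?R = "(\<lambda>v. restrict v (B c \<inter> G)) ` V"
    have "card ?R > 0" using fV pos by (auto simp: card_gt_0_iff)
    then have "ln (real (card ?R)) \<le> ln (real (card (sumset A Y (B c \<inter> G))))"
      using res[rule_format, of "B c \<inter> G"] by simp
    then show "label_entropy V (\<lambda>v. restrict v (B c \<inter> G))
        \<le> real (card V) * ln (real (card (sumset A Y (B c \<inter> G))))"
      using label_entropy_le[OF fV, of "\<lambda>v. restrict v (B c \<inter> G)"]
      by (meson mult_left_mono of_nat_0_le_iff order_trans)
  qed
  also have "\<dots> = real (card V) * (\<Sum>c\<in>C. ln (real (card (sumset A Y (B c \<inter> G)))))"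
    by (simp add: sum_distrib_left)
  finally show ?thesis using pos cV by simp
qed


section \<open>Sumsets under homomorphisms, reindexing, disjoint unions and inclusions\<close>

lemma hom_finprod:
  assumes "comm_group A" "comm_group A'" "h \<in> hom A A'" "finite F" "y \<in> F \<rightarrow> carrier A"
  shows "h (\<Otimes>\<^bsub>A\<^esub>s\<in>F. y s) = (\<Otimes>\<^bsub>A'\<^esub>s\<in>F. h (y s))"
proof -
  interpret A: comm_group A by fact
  interpret A': comm_group A' by fact
  show ?thesis
    using assms(4,5)
  proof (induction F)
    case empty
    show ?case using hom_one[OF assms(3) A.is_group A'.is_group] by simp
  next
    case (insert s F)
    then have "(\<lambda>t. h (y t)) \<in> insert s F \<rightarrow> carrier A'" "y \<in> F \<rightarrow> carrier A" "y s \<in> carrier A"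
      using hom_in_carrier[OF assms(3)] by auto
    with insert show ?case
      using hom_mult[OF assms(3)] by simp
  qed
qed

text \<open>A family in the image sets lifts pointwise to the sets \<open>Y s\<close>, and
  \<open>h\<close> commutes with finite sums.\<close>

lemma sumset_hom_image:
  assumes "comm_group A" "comm_group A'" "h \<in> hom A A'" "finite F"
    and Y: "\<forall>s\<in>F. Y s \<subseteq> carrier A"
  shows "sumset A' (\<lambda>s. h ` Y s) F = h ` sumset A Y F"
proof -
  have h: "h (\<Otimes>\<^bsub>A\<^esub>s\<in>F. y s) = (\<Otimes>\<^bsub>A'\<^esub>s\<in>F. h (y s))" if "y \<in> (\<Pi> s\<in>F. Y s)" for y
    using that Y by (intro hom_finprod[OF assms(1-4)]) fastforce
  have Y': "\<forall>s\<in>F. h ` Y s \<subseteq> carrier A'"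
    using hom_in_carrier[OF assms(3)] Y by blast
  interpret A': comm_group A' by fact
  show ?thesis
  proof
    show "sumset A' (\<lambda>s. h ` Y s) F \<subseteq> h ` sumset A Y F"
    proof
      fix x assume "x \<in> sumset A' (\<lambda>s. h ` Y s) F"
      then obtain z where z: "z \<in> (\<Pi> s\<in>F. h ` Y s)" "x = (\<Otimes>\<^bsub>A'\<^esub>s\<in>F. z s)"
        unfolding sumset_eq_Pi[OF assms(2) Y'] by blast
      from z(1) have "\<forall>s\<in>F. \<exists>v. v \<in> Y s \<and> z s = h v" by (auto simp: Pi_iff)
      then obtain y where y: "\<forall>s\<in>F. y s \<in> Y s \<and> z s = h (y s)" by (rule bchoice[THEN exE])
      have "(\<lambda>s. h (y s)) \<in> F \<rightarrow> carrier A'" using y Y' by blast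
      then have "x = (\<Otimes>\<^bsub>A'\<^esub>s\<in>F. h (y s))"
        unfolding z(2) using y by (intro A'.finprod_cong') auto
      also have "\<dots> = h (\<Otimes>\<^bsub>A\<^esub>s\<in>F. y s)" using y by (intro h[symmetric]) auto
      finally show "x \<in> h ` sumset A Y F"
        using y unfolding sumset_eq_Pi[OF assms(1) Y] by blast
    qed
    show "h ` sumset A Y F \<subseteq> sumset A' (\<lambda>s. h ` Y s) F"
      unfolding sumset_eq_Pi[OF assms(1) Y] sumset_eq_Pi[OF assms(2) Y'] image_image
    proof (rule image_subsetI)
      fix y assume y: "y \<in> (\<Pi> s\<in>F. Y s)"
      then show "h (\<Otimes>\<^bsub>A\<^esub>s\<in>F. y s) \<in> (\<lambda>y. \<Otimes>\<^bsub>A'\<^esub>s\<in>F. y s) ` (\<Pi> s\<in>F. h ` Y s)"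
        by (intro image_eqI[of _ _ "\<lambda>s. h (y s)"]) (auto simp: h)
    qed
  qed
qed

text \<open>Substitution along the injection \<open>f\<close>. The inclusion serves to bound the
  trajectory along a translate from above.\<close>

lemma sumset_reindex_subset:
  assumes "comm_group A" "inj_on f F" and Y: "\<forall>s\<in>F. Y (f s) \<subseteq> carrier A"
  shows "sumset A Y (f ` F) \<subseteq> sumset A (\<lambda>s. Y (f s)) F"
proof -
  interpret comm_group A by fact
  have "(\<Otimes>\<^bsub>A\<^esub>s\<in>f ` F. y s) = (\<Otimes>\<^bsub>A\<^esub>s\<in>F. y (f s))" if "y \<in> (\<Pi> s\<in>f ` F. Y s)" for y
    using that Y assms(2) by (intro finprod_reindex) fastforce+
  moreover have "\<forall>s\<in>f ` F. Y s \<subseteq> carrier A" using Y by blast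
  ultimately show ?thesis
    unfolding sumset_eq_Pi[OF assms(1) Y]
    by (auto simp: sumset_eq_Pi[OF assms(1)] intro!: imageI)
qed

lemma sumset_Un_subset:
  assumes "comm_group A" "finite F" "finite G" "F \<inter> G = {}"
    and Y: "\<forall>s\<in>F \<union> G. Y s \<subseteq> carrier A"
  shows "sumset A Y (F \<union> G) \<subseteq> (\<lambda>(x, y). x \<otimes>\<^bsub>A\<^esub> y) ` (sumset A Y F \<times> sumset A Y G)"
proof -
  interpret comm_group A by fact
  have YF: "\<forall>s\<in>F. Y s \<subseteq> carrier A" and YG: "\<forall>s\<in>G. Y s \<subseteq> carrier A"
    using Y by blast+
  show ?thesis
    unfolding sumset_eq_Pi[OF assms(1) Y] sumset_eq_Pi[OF assms(1) YF] sumset_eq_Pi[OF assms(1) YG]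
  proof (rule image_subsetI)
    fix y assume y: "y \<in> (\<Pi> s\<in>F \<union> G. Y s)"
    have "y \<in> F \<rightarrow> carrier A" "y \<in> G \<rightarrow> carrier A" using y YF YG by fastforce+
    then have "(\<Otimes>\<^bsub>A\<^esub>s\<in>F \<union> G. y s) = (\<Otimes>\<^bsub>A\<^esub>s\<in>F. y s) \<otimes>\<^bsub>A\<^esub> (\<Otimes>\<^bsub>A\<^esub>s\<in>G. y s)"
      using assms(2-4) by (intro finprod_Un_disjoint)
    moreover have "y \<in> (\<Pi> s\<in>F. Y s)" "y \<in> (\<Pi> s\<in>G. Y s)" using y by auto
    ultimately show "(\<Otimes>\<^bsub>A\<^esub>s\<in>F \<union> G. y s) \<in> (\<lambda>(x, y). x \<otimes>\<^bsub>A\<^esub> y) `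
        ((\<lambda>y. \<Otimes>\<^bsub>A\<^esub>s\<in>F. y s) ` (\<Pi> s\<in>F. Y s) \<times> (\<lambda>y. \<Otimes>\<^bsub>A\<^esub>s\<in>G. y s) ` (\<Pi> s\<in>G. Y s))"
      by (intro image_eqI[of _ _ "(\<Otimes>\<^bsub>A\<^esub>s\<in>F. y s, \<Otimes>\<^bsub>A\<^esub>s\<in>G. y s)"]) auto
  qed
qed

text \<open>A family on \<open>F\<close> extends to \<open>G\<close> by the neutral element, which
  leaves its sum unchanged.\<close>

lemma sumset_mono:
  assumes "comm_group A" "finite G" "F \<subseteq> G"
    and Y: "\<forall>s\<in>G. Y s \<subseteq> carrier A \<and> \<one>\<^bsub>A\<^esub> \<in> Y s"
  shows "sumset A Y F \<subseteq> sumset A Y G"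
proof -
  interpret comm_group A by fact
  have YG: "\<forall>s\<in>G. Y s \<subseteq> carrier A" and YF: "\<forall>s\<in>F. Y s \<subseteq> carrier A"
    using Y assms(3) by blast+
  show ?thesis
    unfolding sumset_eq_Pi[OF assms(1) YG] sumset_eq_Pi[OF assms(1) YF]
  proof (rule image_subsetI)
    fix y assume y: "y \<in> (\<Pi> s\<in>F. Y s)"
    let ?z = "\<lambda>s. if s \<in> F then y s else \<one>\<^bsub>A\<^esub>"
    have z: "?z \<in> (\<Pi> s\<in>G. Y s)" using y Y by auto
    then have "?z \<in> G \<rightarrow> carrier A" using YG by fastforce
    then have "(\<Otimes>\<^bsub>A\<^esub>s\<in>G. ?z s) = (\<Otimes>\<^bsub>A\<^esub>s\<in>F. y s)"
      using assms(2,3) by (intro finprod_mono_neutral_cong_right) auto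
    then show "(\<Otimes>\<^bsub>A\<^esub>s\<in>F. y s) \<in> (\<lambda>y. \<Otimes>\<^bsub>A\<^esub>s\<in>G. y s) ` (\<Pi> s\<in>G. Y s)"
      using z by (metis (no_types, lifting) image_eqI)
  qed
qed

section \<open>The entropy as an infimum\<close>

text \<open>The expression whose limit along Folner nets is \<open>H_alg\<close>, made a function of
  the finite set so that its infimum can be taken.\<close>

definition mean_growth ::
  "('x, 'n) monoid_scheme \<Rightarrow> ('s \<Rightarrow> 'x \<Rightarrow> 'x) \<Rightarrow> 'x set \<Rightarrow> 's set \<Rightarrow> real" where
  "mean_growth A lam E F = ln (real (card (trajectory A lam F E))) / real (card F)"

definition finite_parts :: "('s, 'm) monoid_scheme \<Rightarrow> 's set set" where
  "finite_parts S = {F. finite F \<and> F \<noteq> {} \<and> F \<subseteq> carrier S}"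

text \<open>The locale is used twice: for the given action and for the induced action on the
  quotient.\<close>

locale cancel_action = S: monoid_cancel S + A: comm_group A
  for S :: "('s, 'm) monoid_scheme" and A :: "('x, 'n) monoid_scheme" +
  fixes lam :: "'s \<Rightarrow> 'x \<Rightarrow> 'x"
  assumes action: "left_action S A lam"
begin

lemma lam_hom: "s \<in> carrier S \<Longrightarrow> lam s \<in> hom A A"
  using action by (simp add: left_action_def)

lemma lam_closed: "s \<in> carrier S \<Longrightarrow> x \<in> carrier A \<Longrightarrow> lam s x \<in> carrier A"
  using lam_hom hom_in_carrier by metis

lemma lam_mult:
  "s \<in> carrier S \<Longrightarrow> t \<in> carrier S \<Longrightarrow> x \<in> carrier A \<Longrightarrow> lam (s \<otimes>\<^bsub>S\<^esub> t) x = lam s (lam t x)"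
  using action by (simp add: left_action_def)

lemma lam_unit: "x \<in> carrier A \<Longrightarrow> lam \<one>\<^bsub>S\<^esub> x = x"
  using action by (simp add: left_action_def)

lemma lam_one: "s \<in> carrier S \<Longrightarrow> lam s \<one>\<^bsub>A\<^esub> = \<one>\<^bsub>A\<^esub>"
  using lam_hom hom_one A.is_group by metis

lemma lam_image_carrier:
  "F \<subseteq> carrier S \<Longrightarrow> E \<subseteq> carrier A \<Longrightarrow> \<forall>s\<in>F. lam s ` E \<subseteq> carrier A"
  using lam_closed by blast

section \<open>Size and monotonicity of trajectories\<close>

lemma trajectory_eq_sumset:
  assumes "F \<subseteq> carrier S" "E \<subseteq> carrier A"
  shows "trajectory A lam F E = sumset A (\<lambda>s. lam s ` E) F"
  using sumset_eq_Pi[OF A.comm_group_axioms lam_image_carrier[OF assms]]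
  by (auto simp: trajectory_def)

lemma trajectory_carrier:
  assumes "F \<subseteq> carrier S" "E \<subseteq> carrier A"
  shows "trajectory A lam F E \<subseteq> carrier A"
proof -
  have "(\<Otimes>\<^bsub>A\<^esub>s\<in>F. y s) \<in> carrier A" if "y \<in> (\<Pi> s\<in>F. lam s ` E)" for y
    using that lam_image_carrier[OF assms] by (intro A.finprod_closed) blast
  then show ?thesis by (auto simp: trajectory_def)
qed

lemma finite_trajectory:
  assumes "finite F" "F \<subseteq> carrier S" "finite E" "E \<subseteq> carrier A"
  shows "finite (trajectory A lam F E)"
  using assms by (simp add: trajectory_eq_sumset sumset_def finite_PiE)

lemma card_trajectory_pos:
  assumes "finite F" "F \<subseteq> carrier S" "finite E" "E \<subseteq> carrier A" "E \<noteq> {}"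
  shows "0 < card (trajectory A lam F E)"
proof -
  have "trajectory A lam F E \<noteq> {}"
    using assms by (simp add: trajectory_eq_sumset sumset_def PiE_eq_empty_iff)
  then show ?thesis using finite_trajectory[OF assms(1-4)] by (simp add: card_gt_0_iff)
qed

lemma card_trajectory_le_power:
  assumes "finite F" "F \<subseteq> carrier S" "finite E" "E \<subseteq> carrier A"
  shows "card (trajectory A lam F E) \<le> card E ^ card F"
proof -
  have "card (trajectory A lam F E) \<le> card (\<Pi>\<^sub>E s\<in>F. lam s ` E)"
    unfolding trajectory_eq_sumset[OF assms(2,4)] sumset_def
    using assms by (intro card_image_le finite_PiE) auto
  also have "\<dots> = (\<Prod>s\<in>F. card (lam s ` E))" using assms(1) by (rule card_PiE)
  also have "\<dots> \<le> (\<Prod>s\<in>F. card E)" using assms(3) by (intro prod_mono) (simp add: card_image_le)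
  finally show ?thesis by simp
qed

lemma trajectory_mono:
  assumes "finite G" "F \<subseteq> G" "G \<subseteq> carrier S" "E \<subseteq> carrier A" "\<one>\<^bsub>A\<^esub> \<in> E"
  shows "trajectory A lam F E \<subseteq> trajectory A lam G E"
proof -
  have "\<one>\<^bsub>A\<^esub> \<in> lam s ` E" if "s \<in> G" for s
    using that assms(3,5) lam_one[of s] by (metis image_eqI subsetD)
  then have "\<forall>s\<in>G. lam s ` E \<subseteq> carrier A \<and> \<one>\<^bsub>A\<^esub> \<in> lam s ` E"
    using lam_image_carrier[OF assms(3,4)] by blast
  then have "sumset A (\<lambda>s. lam s ` E) F \<subseteq> sumset A (\<lambda>s. lam s ` E) G"
    by (rule sumset_mono[OF A.comm_group_axioms assms(1,2)])
  moreover have "F \<subseteq> carrier S" using assms(2,3) by blast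
  ultimately show ?thesis using trajectory_eq_sumset assms(3,4) by simp
qed

lemma card_trajectory_Un_le:
  assumes "finite F" "F \<subseteq> carrier S" "finite G" "G \<subseteq> carrier S" "F \<inter> G = {}"
    and "finite E" "E \<subseteq> carrier A"
  shows "card (trajectory A lam (F \<union> G) E) \<le> card (trajectory A lam F E) * card (trajectory A lam G E)"
proof -
  let ?T = "\<lambda>F. trajectory A lam F E"
  have fin: "finite (?T F \<times> ?T G)" using assms finite_trajectory by simp
  have FG: "F \<union> G \<subseteq> carrier S" using assms(2,4) by blast
  have "?T (F \<union> G) \<subseteq> (\<lambda>(x, y). x \<otimes>\<^bsub>A\<^esub> y) ` (?T F \<times> ?T G)"
    using sumset_Un_subset[OF A.comm_group_axioms assms(1,3,5) lam_image_carrier[OF FG assms(7)]]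
    unfolding trajectory_eq_sumset[OF FG assms(7)] trajectory_eq_sumset[OF assms(2,7)]
      trajectory_eq_sumset[OF assms(4,7)] .
  then have "card (?T (F \<union> G)) \<le> card ((\<lambda>(x, y). x \<otimes>\<^bsub>A\<^esub> y) ` (?T F \<times> ?T G))"
    using fin by (intro card_mono finite_imageI)
  also have "\<dots> \<le> card (?T F \<times> ?T G)" using fin by (rule card_image_le)
  finally show ?thesis by (simp add: card_cartesian_product)
qed

section \<open>Translates of finite sets and trajectories along them\<close>

lemma inj_on_lmult: "c \<in> carrier S \<Longrightarrow> K \<subseteq> carrier S \<Longrightarrow> inj_on (\<lambda>k. c \<otimes>\<^bsub>S\<^esub> k) K"
  using S.l_cancel by (meson inj_onI subsetD)

lemma inj_on_rmult: "c \<in> carrier S \<Longrightarrow> K \<subseteq> carrier S \<Longrightarrow> inj_on (\<lambda>k. k \<otimes>\<^bsub>S\<^esub> c) K"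
  using S.r_cancel by (meson inj_onI subsetD)

lemma l_coset_eq_image: "c <#\<^bsub>S\<^esub> K = (\<lambda>k. c \<otimes>\<^bsub>S\<^esub> k) ` K"
  by (auto simp: l_coset_def)

lemma r_coset_eq_image: "K #>\<^bsub>S\<^esub> c = (\<lambda>k. k \<otimes>\<^bsub>S\<^esub> c) ` K"
  by (auto simp: r_coset_def)

lemma l_coset_finite_parts:
  "c \<in> carrier S \<Longrightarrow> K \<in> finite_parts S \<Longrightarrow> c <#\<^bsub>S\<^esub> K \<in> finite_parts S"
  by (auto simp: finite_parts_def l_coset_eq_image)

lemma card_l_coset: "c \<in> carrier S \<Longrightarrow> K \<subseteq> carrier S \<Longrightarrow> card (c <#\<^bsub>S\<^esub> K) = card K"
  by (simp add: l_coset_eq_image card_image inj_on_lmult)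

lemma card_r_coset: "c \<in> carrier S \<Longrightarrow> K \<subseteq> carrier S \<Longrightarrow> card (K #>\<^bsub>S\<^esub> c) = card K"
  by (simp add: r_coset_eq_image card_image inj_on_rmult)

text \<open>Each \<open>lam (c k)\<close> is \<open>lam c\<close> after \<open>lam k\<close>, and
  \<open>lam c\<close> is a homomorphism, so it can be pulled out of the sums. Left cancellation
  makes multiplication by \<open>c\<close> an injective reindexing.\<close>

lemma trajectory_l_coset:
  assumes "c \<in> carrier S" "finite K" "K \<subseteq> carrier S" "E \<subseteq> carrier A"
  shows "trajectory A lam (c <#\<^bsub>S\<^esub> K) E \<subseteq> lam c ` trajectory A lam K E"
proof -
  have sub: "c <#\<^bsub>S\<^esub> K \<subseteq> carrier S" using assms by (auto simp: l_coset_eq_image)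
  have "\<forall>k\<in>K. lam (c \<otimes>\<^bsub>S\<^esub> k) ` E \<subseteq> carrier A"
    using lam_image_carrier[OF sub assms(4)] by (simp add: l_coset_eq_image)
  then have "trajectory A lam (c <#\<^bsub>S\<^esub> K) E \<subseteq> sumset A (\<lambda>k. lam (c \<otimes>\<^bsub>S\<^esub> k) ` E) K"
    unfolding trajectory_eq_sumset[OF sub assms(4)] unfolding l_coset_eq_image
    by (rule sumset_reindex_subset[OF A.comm_group_axioms inj_on_lmult[OF assms(1,3)]])
  also have "sumset A (\<lambda>k. lam (c \<otimes>\<^bsub>S\<^esub> k) ` E) K = sumset A (\<lambda>k. lam c ` lam k ` E) K"
  proof -
    have "lam (c \<otimes>\<^bsub>S\<^esub> k) ` E = lam c ` lam k ` E" if "k \<in> K" for k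
      unfolding image_image using that assms by (intro image_cong[OF refl] lam_mult) auto
    then show ?thesis unfolding sumset_def by (simp cong: PiE_cong)
  qed
  also have "\<dots> = lam c ` sumset A (\<lambda>k. lam k ` E) K"
    by (rule sumset_hom_image[OF A.comm_group_axioms A.comm_group_axioms lam_hom[OF assms(1)]
          assms(2) lam_image_carrier[OF assms(3,4)]])
  finally show ?thesis unfolding trajectory_eq_sumset[OF assms(3,4)] .
qed

lemma mean_growth_nonneg: "0 \<le> mean_growth A lam E F"
  \<comment> \<open>An infinite trajectory has \<open>card\<close> 0, where \<open>ln 0 = 0\<close>
    keeps the quotient nonnegative.\<close>
  by (cases "card (trajectory A lam F E) = 0") (auto simp: mean_growth_def)

text \<open>The translates \<open>c K\<close> with \<open>c \<in> F\<close> cover every \<open>g \<in> F\<close> that lies in all \<open>F k\<close> at least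
  \<open>card K\<close> times, so Shearer's inequality applies to the set of these \<open>g\<close>.\<close>

lemma mean_growth_le:
  assumes F: "F \<in> finite_parts S" and K: "K \<in> finite_parts S"
    and E: "finite E" "E \<subseteq> carrier A" "\<one>\<^bsub>A\<^esub> \<in> E"
  shows "mean_growth A lam E F \<le> mean_growth A lam E K
      + ln (real (card E)) * (\<Sum>k\<in>K. real (card ((F #>\<^bsub>S\<^esub> k) - F)) / real (card F))"
proof -
  let ?f = "\<lambda>F. ln (real (card (trajectory A lam F E)))"
  have fF: "finite F" "F \<noteq> {}" "F \<subseteq> carrier S" and fK: "finite K" "K \<noteq> {}" "K \<subseteq> carrier S"
    using F K by (auto simp: finite_parts_def)
  have E0: "E \<noteq> {}" using E(3) by blast
  have cF: "real (card F) > 0" and cK: "real (card K) > 0" and cE: "real (card E) \<ge> 1"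
    using fF fK E E0 by (auto simp: card_gt_0_iff Suc_le_eq)
  have f_mono: "?f B \<le> ?f C" if "B \<subseteq> C" "finite C" "C \<subseteq> carrier S" for B C
  proof -
    have B: "finite B" "B \<subseteq> carrier S" using that finite_subset by auto
    have "card (trajectory A lam B E) \<le> card (trajectory A lam C E)"
      using that E by (intro card_mono finite_trajectory trajectory_mono)
    then show ?thesis using card_trajectory_pos[OF B E(1,2) E0] by simp
  qed
  define G where "G = {g \<in> F. \<forall>k\<in>K. g \<in> F #>\<^bsub>S\<^esub> k}"
  have G: "G \<subseteq> F" "finite G" "G \<subseteq> carrier S" using fF by (auto simp: G_def)
  have cover: "card K \<le> card {c \<in> F. g \<in> c <#\<^bsub>S\<^esub> K}" if g: "g \<in> G" for g
  proof -
    have "\<forall>k\<in>K. \<exists>c. c \<in> F \<and> g = c \<otimes>\<^bsub>S\<^esub> k" using g by (auto simp: G_def r_coset_def)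
    \<comment> \<open>The translate of \<open>K\<close> by \<open>\<phi> k\<close> contains
      \<open>g\<close> as the image of \<open>k\<close>. By left cancellation distinct
      \<open>k\<close> give distinct \<open>\<phi> k\<close>, so at least \<open>card K\<close>
      translates contain \<open>g\<close>.\<close>
    then obtain \<phi> where \<phi>: "\<forall>k\<in>K. \<phi> k \<in> F \<and> g = \<phi> k \<otimes>\<^bsub>S\<^esub> k" by (rule bchoice[THEN exE])
    have "inj_on \<phi> K"
    proof (rule inj_onI)
      fix k l assume kl: "k \<in> K" "l \<in> K" "\<phi> k = \<phi> l"
      then have "\<phi> k \<otimes>\<^bsub>S\<^esub> k = \<phi> k \<otimes>\<^bsub>S\<^esub> l" using \<phi> by metis
      then show "k = l" using kl \<phi> fF(3) fK(3) by (intro S.l_cancel[of "\<phi> k" k l]) auto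
    qed
    moreover have "\<phi> ` K \<subseteq> {c \<in> F. g \<in> c <#\<^bsub>S\<^esub> K}"
      using \<phi> unfolding l_coset_def by blast
    ultimately show ?thesis using fF(1) by (intro card_inj_on_le) auto
  qed
  have "real (card K) * ?f G \<le> (\<Sum>c\<in>F. ?f ((c <#\<^bsub>S\<^esub> K) \<inter> G))"
  proof -
    have Y: "\<forall>s\<in>G. finite (lam s ` E) \<and> lam s ` E \<noteq> {} \<and> lam s ` E \<subseteq> carrier A"
      using lam_image_carrier[OF G(3) E(2)] E(1) E0 by blast
    have "real (card K) * ln (real (card (sumset A (\<lambda>s. lam s ` E) G)))
        \<le> (\<Sum>c\<in>F. ln (real (card (sumset A (\<lambda>s. lam s ` E) ((c <#\<^bsub>S\<^esub> K) \<inter> G)))))"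
      by (rule shearer_sumset[OF A.comm_group_axioms G(2) Y fF(1) cover])
    moreover have "(c <#\<^bsub>S\<^esub> K) \<inter> G \<subseteq> carrier S" for c using G(3) by blast
    ultimately show ?thesis using G(3) E(2) by (simp add: trajectory_eq_sumset)
  qed
  \<comment> \<open>Shrinking \<open>c K\<close> to its part in \<open>G\<close> does not enlarge
    the trajectory, and the trajectory along \<open>c K\<close> lies in the image under
    \<open>lam c\<close> of the one along \<open>K\<close>.\<close>
  also have "\<dots> \<le> (\<Sum>c\<in>F. ?f K)"
  proof (rule sum_mono)
    fix c assume c: "c \<in> F"
    then have cS: "c \<in> carrier S" using fF(3) by blast
    have cK': "finite (c <#\<^bsub>S\<^esub> K)" "c <#\<^bsub>S\<^esub> K \<subseteq> carrier S"
      using l_coset_finite_parts[OF cS K] by (auto simp: finite_parts_def)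
    have "card (trajectory A lam (c <#\<^bsub>S\<^esub> K) E) \<le> card (lam c ` trajectory A lam K E)"
      using cS fK E by (intro card_mono finite_imageI finite_trajectory trajectory_l_coset)
    also have "\<dots> \<le> card (trajectory A lam K E)"
      using fK E by (intro card_image_le finite_trajectory)
    finally have "?f (c <#\<^bsub>S\<^esub> K) \<le> ?f K"
      using card_trajectory_pos[OF cK' E(1,2) E0] by simp
    moreover have "?f ((c <#\<^bsub>S\<^esub> K) \<inter> G) \<le> ?f (c <#\<^bsub>S\<^esub> K)"
      using cK' by (intro f_mono) auto
    ultimately show "?f ((c <#\<^bsub>S\<^esub> K) \<inter> G) \<le> ?f K" by simp
  qed
  finally have "real (card K) * ?f G \<le> real (card F) * ?f K" by simp
  then have fG: "?f G \<le> real (card F) * mean_growth A lam E K"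
    using cK by (simp add: mean_growth_def field_simps)
  \<comment> \<open>Every element of \<open>F - G\<close> misses some \<open>F k\<close>. Right
    cancellation gives \<open>card (F k) = card F\<close>, so \<open>F - F k\<close> and
    \<open>F k - F\<close> have equal size and the Folner quotients control the loss.\<close>
  have "F - G \<subseteq> (\<Union>k\<in>K. F - (F #>\<^bsub>S\<^esub> k))" by (auto simp: G_def)
  then have "card (F - G) \<le> card (\<Union>k\<in>K. F - (F #>\<^bsub>S\<^esub> k))"
    using fF fK by (intro card_mono) auto
  also have "\<dots> \<le> (\<Sum>k\<in>K. card (F - (F #>\<^bsub>S\<^esub> k)))"
    using fK(1) by (rule card_UN_le)
  also have "\<dots> = (\<Sum>k\<in>K. card ((F #>\<^bsub>S\<^esub> k) - F))"
  proof (rule sum.cong[OF refl])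
    fix k assume "k \<in> K"
    then have "card (F #>\<^bsub>S\<^esub> k) = card F" "finite (F #>\<^bsub>S\<^esub> k)"
      using card_r_coset fF fK by (auto simp: r_coset_eq_image)
    then show "card (F - (F #>\<^bsub>S\<^esub> k)) = card ((F #>\<^bsub>S\<^esub> k) - F)"
      using fF(1) by (simp add: card_Diff_subset_Int Int_commute)
  qed
  finally have cFG: "real (card (F - G)) \<le> (\<Sum>k\<in>K. real (card ((F #>\<^bsub>S\<^esub> k) - F)))"
    by (simp flip: of_nat_sum)
  have FG: "finite (F - G)" "F - G \<subseteq> carrier S" using fF by auto
  \<comment> \<open>Splitting off \<open>F - G\<close> costs at most \<open>ln (card E)\<close> per
    element, by counting families.\<close>
  have "card (trajectory A lam F E) \<le> card (trajectory A lam G E) * card (trajectory A lam (F - G) E)"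
    using card_trajectory_Un_le[OF G(2,3) FG _ E(1,2)] G(1) by (simp add: Un_absorb1)
  also have "\<dots> \<le> card (trajectory A lam G E) * card E ^ card (F - G)"
    using card_trajectory_le_power[OF FG E(1,2)] by simp
  finally have "real (card (trajectory A lam F E))
      \<le> real (card (trajectory A lam G E)) * real (card E) ^ card (F - G)"
    by (simp flip: of_nat_power of_nat_mult)
  then have "?f F \<le> ln (real (card (trajectory A lam G E)) * real (card E) ^ card (F - G))"
    using card_trajectory_pos[OF fF(1,3) E(1,2) E0] by simp
  also have "\<dots> = ?f G + real (card (F - G)) * ln (real (card E))"
    using card_trajectory_pos[OF G(2,3) E(1,2) E0] cE by (simp add: ln_mult ln_realpow)
  also have "\<dots> \<le> real (card F) * mean_growth A lam E K
      + (\<Sum>k\<in>K. real (card ((F #>\<^bsub>S\<^esub> k) - F))) * ln (real (card E))"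
    using fG cFG cE by (intro add_mono mult_right_mono) auto
  finally have "mean_growth A lam E F \<le> (real (card F) * mean_growth A lam E K
      + (\<Sum>k\<in>K. real (card ((F #>\<^bsub>S\<^esub> k) - F))) * ln (real (card E))) / real (card F)"
    unfolding mean_growth_def[of A lam E F] using cF by (intro divide_right_mono) auto
  then show ?thesis
    using cF by (simp add: add_divide_distrib sum_divide_distrib[symmetric] mult.commute)
qed

text \<open>No value lies below the infimum. From above, fix \<open>K\<close> whose mean growth is
  already less than \<open>a\<close>; the error term of \<open>mean_growth_le\<close> for this
  \<open>K\<close> is a multiple of a finite sum of Folner quotients and tends to 0.\<close>

lemma mean_growth_tendsto:
  assumes net: "right_folner_net S I r F"
    and E: "finite E" "E \<subseteq> carrier A" "\<one>\<^bsub>A\<^esub> \<in> E"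
  shows "((\<lambda>i. mean_growth A lam E (F i)) \<longlongrightarrow> (INF K\<in>finite_parts S. mean_growth A lam E K))
      (net_filter I r)"
    (is "(_ \<longlongrightarrow> ?L) _")
proof (rule order_tendstoI)
  have bdd: "bdd_below (mean_growth A lam E ` finite_parts S)"
    using mean_growth_nonneg by (intro bdd_belowI[of _ 0]) auto
  have dir: "directed_on I r" and Fi: "\<And>i. i \<in> I \<Longrightarrow> F i \<in> finite_parts S"
    using net by (auto simp: right_folner_net_def finite_parts_def)
  have ne: "I \<noteq> {}" and rI: "r \<subseteq> I \<times> I" using dir by (auto simp: directed_on_def preorder_on_def refl_on_def)
  have evI: "\<forall>\<^sub>F i in net_filter I r. i \<in> I"
    unfolding eventually_net_filter[OF dir] using ne rI by blast
  show "\<forall>\<^sub>F i in net_filter I r. a < mean_growth A lam E (F i)" if "a < ?L" for a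
    using evI
  proof eventually_elim
    case (elim i)
    then show ?case using that cINF_lower[OF bdd Fi[OF elim]] by linarith
  qed
  show "\<forall>\<^sub>F i in net_filter I r. mean_growth A lam E (F i) < a" if less: "?L < a" for a
  proof -
    have "finite_parts S \<noteq> {}" using ne Fi by blast
    then obtain K where K: "K \<in> finite_parts S" "mean_growth A lam E K < a"
      using cINF_less_iff[OF _ bdd, of a] less by blast
    let ?u = "\<lambda>i. mean_growth A lam E K + ln (real (card E))
        * (\<Sum>k\<in>K. real (card ((F i #>\<^bsub>S\<^esub> k) - F i)) / real (card (F i)))"
    have "(?u \<longlongrightarrow> mean_growth A lam E K + ln (real (card E)) * (\<Sum>k\<in>K. 0)) (net_filter I r)"
      using net K(1)
      by (intro tendsto_add tendsto_mult tendsto_sum tendsto_const)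
        (auto simp: right_folner_net_def finite_parts_def)
    then have "\<forall>\<^sub>F i in net_filter I r. ?u i < a"
      using K(2) by (intro order_tendstoD(2)) auto
    then show ?thesis using evI
    proof eventually_elim
      case (elim i)
      then show ?case using mean_growth_le[OF Fi[OF elim(2)] K(1) E] by linarith
    qed
  qed
qed

text \<open>The infimum is the limit along every right Folner net. Amenability supplies one such
  net, and uniqueness of limits along it shows that no other number qualifies.\<close>

lemma H_alg_eq_INF:
  assumes "right_amenable S" and E: "finite E" "E \<subseteq> carrier A" "\<one>\<^bsub>A\<^esub> \<in> E"
  shows "H_alg S A lam E = (INF K\<in>finite_parts S. mean_growth A lam E K)"
  unfolding H_alg_def mean_growth_def[symmetric]
proof (rule the_equality)
  show "\<forall>(I :: 's net_index set) r F. right_folner_net S I r F \<longrightarrow>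
      ((\<lambda>i. mean_growth A lam E (F i)) \<longlongrightarrow> (INF K\<in>finite_parts S. mean_growth A lam E K))
        (net_filter I r)"
    using mean_growth_tendsto[OF _ E] by blast
next
  fix L
  assume L: "\<forall>(I :: 's net_index set) r F. right_folner_net S I r F \<longrightarrow>
      ((\<lambda>i. mean_growth A lam E (F i)) \<longlongrightarrow> L) (net_filter I r)"
  obtain I :: "'s net_index set" and r F where net: "right_folner_net S I r F"
    using assms(1) by (auto simp: right_amenable_def)
  then have dir: "directed_on I r" by (simp add: right_folner_net_def)
  \<comment> \<open>Each tail contains its starting index by reflexivity, so the tail filter is
    proper.\<close>
  then have "net_filter I r \<noteq> bot"
    unfolding trivial_limit_def eventually_net_filter[OF dir]
    by (auto simp: directed_on_def preorder_on_def refl_on_def)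
  then show "L = (INF K\<in>finite_parts S. mean_growth A lam E K)"
    using L net mean_growth_tendsto[OF net E] tendsto_unique by blast
qed

end

section \<open>The quotient by the kernel\<close>

text \<open>On \<open>T\<close> the map \<open>g\<close> factors through \<open>f\<close>.\<close>

lemma card_image_le_if_finer:
  assumes "finite T" "\<And>x y. x \<in> T \<Longrightarrow> y \<in> T \<Longrightarrow> f x = f y \<Longrightarrow> g x = g y"
  shows "card (g ` T) \<le> card (f ` T)"
proof -
  have "g ` T \<subseteq> (g \<circ> inv_into T f) ` f ` T"
  proof (rule image_subsetI)
    fix x assume x: "x \<in> T"
    have "inv_into T f (f x) \<in> T" "f (inv_into T f (f x)) = f x"
      using x by (auto intro: inv_into_into f_inv_into_f)
    then have "g (inv_into T f (f x)) = g x" using assms(2)[OF _ x] by blast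
    then have "g x = (g \<circ> inv_into T f) (f x)" by simp
    then show "g x \<in> (g \<circ> inv_into T f) ` f ` T" using x by blast
  qed
  moreover have "finite (f ` T)" using assms(1) by simp
  ultimately show ?thesis by (rule surj_card_le[rotated])
qed

text \<open>A Folner set meets both of its translates by \<open>s\<close> and \<open>t\<close> in more than half of its elements.\<close>

lemma (in monoid_cancel) left_Ore:
  assumes "right_amenable G" and s: "s \<in> carrier G" and t: "t \<in> carrier G"
  obtains a b where "a \<in> carrier G" "b \<in> carrier G" "a \<otimes> s = b \<otimes> t"
proof -
  obtain I :: "'a net_index set" and r F where net: "right_folner_net G I r F"
    using assms(1) by (auto simp: right_amenable_def)
  then have dir: "directed_on I r" by (simp add: right_folner_net_def)
  have small: "\<forall>\<^sub>F i in net_filter I r. real (card ((F i #> u) - F i)) / real (card (F i)) < 1 / 2"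
    if "u \<in> carrier G" for u
    using net that unfolding right_folner_net_def by (intro order_tendstoD(2)[of _ 0]) auto
  obtain i where i: "i \<in> I"
    "real (card ((F i #> s) - F i)) / real (card (F i)) < 1 / 2"
    "real (card ((F i #> t) - F i)) / real (card (F i)) < 1 / 2"
    using eventually_conj[OF small[OF s] small[OF t]] dir
    unfolding eventually_net_filter[OF dir] directed_on_def preorder_on_def refl_on_def by blast
  have F: "finite (F i)" "F i \<noteq> {}" "F i \<subseteq> carrier G"
    using net i(1) by (auto simp: right_folner_net_def)
  have half: "2 * card ((F i #> u) \<inter> F i) > card (F i)"
    if u: "u \<in> carrier G" and lt: "real (card ((F i #> u) - F i)) / real (card (F i)) < 1 / 2" for u
  proof -
    have im: "F i #> u = (\<lambda>x. x \<otimes> u) ` F i" by (auto simp: r_coset_def)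
    have "inj_on (\<lambda>x. x \<otimes> u) (F i)" using r_cancel u F(3) by (meson inj_onI subsetD)
    then have "card (F i #> u) = card (F i)" unfolding im by (rule card_image)
    moreover have "card (F i #> u) = card ((F i #> u) \<inter> F i) + card ((F i #> u) - F i)"
      using F(1) im by (metis card_Int_Diff finite_imageI)
    moreover have "card (F i) > 0" using F by (simp add: card_gt_0_iff)
    then have "2 * real (card ((F i #> u) - F i)) < real (card (F i))"
      using lt by (simp add: divide_less_eq)
    ultimately show ?thesis by linarith
  qed
  have "(F i #> s) \<inter> F i \<inter> ((F i #> t) \<inter> F i) \<noteq> {}"
  proof
    assume "(F i #> s) \<inter> F i \<inter> ((F i #> t) \<inter> F i) = {}"
    then have "card ((F i #> s) \<inter> F i) + card ((F i #> t) \<inter> F i)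
        = card (((F i #> s) \<inter> F i) \<union> ((F i #> t) \<inter> F i))"
      using F(1) by (intro card_Un_disjoint[symmetric]) auto
    also have "\<dots> \<le> card (F i)" using F(1) by (intro card_mono) auto
    finally show False using half[OF s i(2)] half[OF t i(3)] by linarith
  qed
  then obtain a b where "a \<in> F i" "b \<in> F i" "a \<otimes> s = b \<otimes> t" by (auto simp: r_coset_def)
  then show thesis using that F(3) by blast
qed

locale amenable_action = cancel_action S A lam
  for S :: "('s, 'm) monoid_scheme" and A :: "('x, 'n) monoid_scheme" and lam :: "'s \<Rightarrow> 'x \<Rightarrow> 'x" +
  assumes amenable: "right_amenable S"
begin

abbreviation ker :: "'x set" where
  "ker \<equiv> action_kernel S A lam"

abbreviation quot_map :: "'x \<Rightarrow> 'x set" where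
  "quot_map x \<equiv> ker #>\<^bsub>A\<^esub> x"

section \<open>The kernel as an invariant subgroup\<close>

lemma mem_ker_iff: "x \<in> ker \<longleftrightarrow> x \<in> carrier A \<and> (\<exists>s\<in>carrier S. lam s x = \<one>\<^bsub>A\<^esub>)"
  by (auto simp: action_kernel_def kernel_def)

text \<open>If \<open>s\<close> kills \<open>Y\<close> and \<open>t\<close> kills \<open>x\<close>,
  a common multiple \<open>a s = b t\<close> kills both, as homomorphisms fix the neutral
  element.\<close>

lemma common_annihilator:
  assumes "finite Y" "Y \<subseteq> ker"
  shows "\<exists>s\<in>carrier S. \<forall>x\<in>Y. lam s x = \<one>\<^bsub>A\<^esub>"
  using assms
proof (induction Y)
  case empty
  then show ?case using S.one_closed by blast
next
  case (insert x Y)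
  then obtain s where s: "s \<in> carrier S" "\<forall>y\<in>Y. lam s y = \<one>\<^bsub>A\<^esub>" by auto
  obtain t where t: "t \<in> carrier S" "lam t x = \<one>\<^bsub>A\<^esub>" using insert.prems mem_ker_iff by blast
  obtain a b where ab: "a \<in> carrier S" "b \<in> carrier S" "a \<otimes>\<^bsub>S\<^esub> s = b \<otimes>\<^bsub>S\<^esub> t"
    using S.left_Ore[OF amenable s(1) t(1)] .
  have car: "insert x Y \<subseteq> carrier A" using insert.prems mem_ker_iff by blast
  have "lam (a \<otimes>\<^bsub>S\<^esub> s) y = \<one>\<^bsub>A\<^esub>" if "y \<in> insert x Y" for y
  proof (cases "y = x")
    case True
    then show ?thesis using car t ab lam_mult[of b t x] lam_one[of b] by simp
  next
    case False
    then have "y \<in> Y" "y \<in> carrier A" using that car by auto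
    then show ?thesis using s ab(1) lam_mult[of a s y] lam_one[of a] by simp
  qed
  then show ?case using s(1) ab(1) S.m_closed by blast
qed

text \<open>Two elements of the union of the kernels already lie in the kernel of a single
  \<open>lam s\<close>, which gives closure under the group operation.\<close>

lemma subgroup_ker: "subgroup ker A"
proof (rule A.subgroupI)
  show "ker \<subseteq> carrier A" by (auto simp: mem_ker_iff)
  have "\<one>\<^bsub>A\<^esub> \<in> ker" using lam_one[OF S.one_closed] S.one_closed mem_ker_iff by blast
  then show "ker \<noteq> {}" by blast
next
  fix x assume x: "x \<in> ker"
  then obtain s where s: "x \<in> carrier A" "s \<in> carrier S" "lam s x = \<one>\<^bsub>A\<^esub>"
    by (auto simp: mem_ker_iff)
  interpret group_hom A A "lam s"
    using lam_hom[OF s(2)] by (simp add: group_hom_def group_hom_axioms_def A.is_group)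
  have "lam s (inv\<^bsub>A\<^esub> x) = \<one>\<^bsub>A\<^esub>" using s by simp
  moreover have "inv\<^bsub>A\<^esub> x \<in> carrier A" using s(1) by simp
  ultimately show "inv\<^bsub>A\<^esub> x \<in> ker" using s(2) mem_ker_iff by blast
next
  fix x y assume xy: "x \<in> ker" "y \<in> ker"
  then obtain s where s: "s \<in> carrier S" "lam s x = \<one>\<^bsub>A\<^esub>" "lam s y = \<one>\<^bsub>A\<^esub>"
    using common_annihilator[of "{x, y}"] by auto
  have car: "x \<in> carrier A" "y \<in> carrier A" using xy mem_ker_iff by blast+
  have "lam s (x \<otimes>\<^bsub>A\<^esub> y) = \<one>\<^bsub>A\<^esub>" using hom_mult[OF lam_hom[OF s(1)] car] s by simp
  then show "x \<otimes>\<^bsub>A\<^esub> y \<in> ker" using s(1) A.m_closed[OF car] mem_ker_iff by blast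
qed

text \<open>If \<open>t\<close> kills \<open>x\<close> and \<open>a s = b t\<close>, then
  \<open>a\<close> kills \<open>lam s x\<close>.\<close>

lemma lam_ker:
  assumes s: "s \<in> carrier S"
  shows "lam s ` ker \<subseteq> ker"
proof (rule image_subsetI)
  fix x assume "x \<in> ker"
  then obtain t where t: "x \<in> carrier A" "t \<in> carrier S" "lam t x = \<one>\<^bsub>A\<^esub>"
    by (auto simp: mem_ker_iff)
  obtain a b where ab: "a \<in> carrier S" "b \<in> carrier S" "a \<otimes>\<^bsub>S\<^esub> s = b \<otimes>\<^bsub>S\<^esub> t"
    using S.left_Ore[OF amenable s t(2)] .
  have "lam a (lam s x) = lam b (lam t x)"
    using lam_mult[OF ab(1) s t(1)] lam_mult[OF ab(2) t(2,1)] ab(3) by simp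
  then have "lam a (lam s x) = \<one>\<^bsub>A\<^esub>" using t(3) lam_one[OF ab(2)] by simp
  then show "lam s x \<in> ker" using ab(1) lam_closed[OF s t(1)] mem_ker_iff by blast
qed

section \<open>The induced action on the quotient group\<close>

lemma quot_map_hom: "quot_map \<in> hom A (A Mod ker)"
proof -
  have "ker \<lhd> A" using subgroup_ker A.normal_iff_subgroup by blast
  then show ?thesis by (rule normal.r_coset_hom_Mod)
qed

lemma carrier_quot: "carrier (A Mod ker) = quot_map ` carrier A"
  by (auto simp: FactGroup_def RCOSETS_def)

lemma comm_group_quot: "comm_group (A Mod ker)"
  using subgroup_ker by (rule A.abelian_FactGroup)

lemma induced_quot_map:
  "s \<in> carrier S \<Longrightarrow> x \<in> carrier A \<Longrightarrow> induced_action A ker lam s (quot_map x) = quot_map (lam s x)"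
  by (intro induced_action_coset A.comm_group_axioms subgroup_ker lam_hom lam_ker)

lemma left_action_quot: "left_action S (A Mod ker) (induced_action A ker lam)"
  unfolding left_action_def
proof (intro conjI ballI)
  fix s assume s: "s \<in> carrier S"
  show "induced_action A ker lam s \<in> hom (A Mod ker) (A Mod ker)"
  proof (rule homI)
    fix x assume "x \<in> carrier (A Mod ker)"
    then show "induced_action A ker lam s x \<in> carrier (A Mod ker)"
      unfolding carrier_quot using induced_quot_map[OF s] lam_closed[OF s] by auto
  next
    fix x y assume "x \<in> carrier (A Mod ker)" "y \<in> carrier (A Mod ker)"
    then obtain u v where uv: "u \<in> carrier A" "v \<in> carrier A" "x = quot_map u" "y = quot_map v"
      unfolding carrier_quot by blast
    note q = hom_mult[OF quot_map_hom]
    have "induced_action A ker lam s (x \<otimes>\<^bsub>A Mod ker\<^esub> y) = quot_map (lam s (u \<otimes>\<^bsub>A\<^esub> v))"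
      unfolding uv(3,4) q[OF uv(1,2), symmetric]
      by (rule induced_quot_map[OF s A.m_closed[OF uv(1,2)]])
    also have "\<dots> = quot_map (lam s u) \<otimes>\<^bsub>A Mod ker\<^esub> quot_map (lam s v)"
      unfolding hom_mult[OF lam_hom[OF s] uv(1,2)]
      by (rule q[OF lam_closed[OF s uv(1)] lam_closed[OF s uv(2)]])
    finally show "induced_action A ker lam s (x \<otimes>\<^bsub>A Mod ker\<^esub> y)
        = induced_action A ker lam s x \<otimes>\<^bsub>A Mod ker\<^esub> induced_action A ker lam s y"
      unfolding uv(3,4) induced_quot_map[OF s uv(1)] induced_quot_map[OF s uv(2)] .
  qed
next
  fix x assume "x \<in> carrier (A Mod ker)"
  then show "induced_action A ker lam \<one>\<^bsub>S\<^esub> x = x"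
    using induced_quot_map[OF S.one_closed] lam_unit unfolding carrier_quot by auto
next
  fix s t x assume s: "s \<in> carrier S" and t: "t \<in> carrier S" and "x \<in> carrier (A Mod ker)"
  then obtain u where u: "u \<in> carrier A" "x = quot_map u" unfolding carrier_quot by blast
  then show "induced_action A ker lam (s \<otimes>\<^bsub>S\<^esub> t) x
      = induced_action A ker lam s (induced_action A ker lam t x)"
    using induced_quot_map[OF S.m_closed[OF s t] u(1)] induced_quot_map[OF t u(1)]
      induced_quot_map[OF s lam_closed[OF t u(1)]] lam_mult[OF s t u(1)] by simp
qed

text \<open>This makes the results on trajectories, in particular the infimum formula, available for
  the quotient.\<close>

sublocale Q: cancel_action S "A Mod ker" "induced_action A ker lam"
  using S.monoid_cancel_axioms comm_group_quot left_action_quot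
  by (simp add: cancel_action_def cancel_action_axioms_def)

text \<open>The quotient map is a homomorphism that intertwines the two actions, so it commutes with
  forming trajectories.\<close>

lemma trajectory_quot:
  assumes "finite F" "F \<subseteq> carrier S" "E \<subseteq> carrier A"
  shows "trajectory (A Mod ker) (induced_action A ker lam) F (quot_map ` E)
      = quot_map ` trajectory A lam F E"
proof -
  have E: "quot_map ` E \<subseteq> carrier (A Mod ker)" using assms(3) unfolding carrier_quot by blast
  have "induced_action A ker lam s ` quot_map ` E = quot_map ` lam s ` E" if "s \<in> F" for s
    unfolding image_image using that assms by (intro image_cong refl induced_quot_map) auto
  then have "trajectory (A Mod ker) (induced_action A ker lam) F (quot_map ` E)
      = sumset (A Mod ker) (\<lambda>s. quot_map ` lam s ` E) F"
    unfolding Q.trajectory_eq_sumset[OF assms(2) E] sumset_def by (simp cong: PiE_cong)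
  also have "\<dots> = quot_map ` sumset A (\<lambda>s. lam s ` E) F"
    by (rule sumset_hom_image[OF A.comm_group_axioms comm_group_quot quot_map_hom assms(1)
          lam_image_carrier[OF assms(2,3)]])
  finally show ?thesis unfolding trajectory_eq_sumset[OF assms(2,3)] .
qed

text \<open>Elements of \<open>T\<close> with the same coset differ by an element of the kernel.
  Only finitely many such differences occur, so one \<open>s\<close> annihilates them all and
  \<open>lam s\<close> identifies whatever the quotient map identifies on \<open>T\<close>.\<close>

lemma quot_map_collapse:
  assumes "finite T" "T \<subseteq> carrier A"
  obtains s where "s \<in> carrier S" "card (lam s ` T) \<le> card (quot_map ` T)"
proof -
  let ?Y = "(\<lambda>(x, y). x \<otimes>\<^bsub>A\<^esub> inv\<^bsub>A\<^esub> y) ` (T \<times> T) \<inter> ker"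
  have "finite ?Y" using assms(1) by blast
  then obtain s where s: "s \<in> carrier S" "\<forall>z\<in>?Y. lam s z = \<one>\<^bsub>A\<^esub>"
    using common_annihilator[of ?Y] by blast
  have "lam s x = lam s y" if xy: "x \<in> T" "y \<in> T" "quot_map x = quot_map y" for x y
  proof -
    have car: "x \<in> carrier A" "y \<in> carrier A" using xy assms(2) by auto
    have "x \<in> quot_map y" using A.rcos_self[OF car(1) subgroup_ker] xy(3) by simp
    then obtain k where k: "k \<in> ker" "x = k \<otimes>\<^bsub>A\<^esub> y" by (auto simp: r_coset_def)
    have kc: "k \<in> carrier A" using k(1) mem_ker_iff by blast
    have "k = x \<otimes>\<^bsub>A\<^esub> inv\<^bsub>A\<^esub> y" using k(2) kc car by (simp add: A.m_assoc)
    then have "k \<in> ?Y" using k(1) xy(1,2) by (intro IntI image_eqI[of _ _ "(x, y)"]) auto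
    then have "lam s k = \<one>\<^bsub>A\<^esub>" using s(2) by blast
    then show ?thesis
      using k(2) hom_mult[OF lam_hom[OF s(1)] kc car(2)] lam_closed[OF s(1) car(2)] by simp
  qed
  then have "card (lam s ` T) \<le> card (quot_map ` T)"
    using assms(1) by (intro card_image_le_if_finer)
  then show thesis using s(1) that by blast
qed

section \<open>Equality of the two entropies\<close>

lemma quot_map_one: "quot_map \<one>\<^bsub>A\<^esub> = \<one>\<^bsub>A Mod ker\<^esub>"
  by (rule hom_one[OF quot_map_hom A.is_group Q.A.is_group])

lemma mean_growth_quot_le:
  assumes E: "finite E" "E \<subseteq> carrier A" "E \<noteq> {}" and "F \<in> finite_parts S"
  shows "mean_growth (A Mod ker) (induced_action A ker lam) (quot_map ` E) F \<le> mean_growth A lam E F"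
proof -
  have F: "finite F" "F \<subseteq> carrier S" using assms(4) by (auto simp: finite_parts_def)
  let ?T = "trajectory A lam F E"
  have "card (quot_map ` ?T) \<le> card ?T"
    using finite_trajectory[OF F E(1,2)] by (rule card_image_le)
  moreover have "finite ?T" "?T \<noteq> {}"
    using card_trajectory_pos[OF F E] by (auto simp: card_gt_0_iff)
  then have "0 < card (quot_map ` ?T)" by (simp add: card_gt_0_iff)
  ultimately show ?thesis
    unfolding mean_growth_def trajectory_quot[OF F E(2)] by (intro divide_right_mono) auto
qed

text \<open>If \<open>lam s\<close> collapses the trajectory along \<open>F\<close> as the quotient map does, then the trajectory
  along \<open>s F\<close> is no larger than that of the quotient along \<open>F\<close>.\<close>

lemma mean_growth_quot_ge:
  assumes E: "finite E" "E \<subseteq> carrier A" "E \<noteq> {}" and FS: "F \<in> finite_parts S"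
  shows "\<exists>F'\<in>finite_parts S. mean_growth A lam E F'
      \<le> mean_growth (A Mod ker) (induced_action A ker lam) (quot_map ` E) F"
proof -
  have F: "finite F" "F \<subseteq> carrier S" using FS by (auto simp: finite_parts_def)
  let ?T = "trajectory A lam F E"
  obtain s where s: "s \<in> carrier S" "card (lam s ` ?T) \<le> card (quot_map ` ?T)"
    using quot_map_collapse[OF finite_trajectory[OF F E(1,2)] trajectory_carrier[OF F(2) E(2)]] .
  have sF: "s <#\<^bsub>S\<^esub> F \<in> finite_parts S" using s(1) FS by (rule l_coset_finite_parts)
  then have sF': "finite (s <#\<^bsub>S\<^esub> F)" "s <#\<^bsub>S\<^esub> F \<subseteq> carrier S"
    by (auto simp: finite_parts_def)
  have "card (trajectory A lam (s <#\<^bsub>S\<^esub> F) E) \<le> card (lam s ` ?T)"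
    using trajectory_l_coset[OF s(1) F E(2)] finite_trajectory[OF F E(1,2)]
    by (intro card_mono finite_imageI)
  also note s(2)
  finally have "mean_growth A lam E (s <#\<^bsub>S\<^esub> F)
      \<le> mean_growth (A Mod ker) (induced_action A ker lam) (quot_map ` E) F"
    using card_trajectory_pos[OF sF' E]
    unfolding mean_growth_def trajectory_quot[OF F E(2)] card_l_coset[OF s(1) F(2)]
    by (intro divide_right_mono) auto
  then show ?thesis using sF by blast
qed

text \<open>One infimum bounds the other term by term; conversely every term for the quotient
  dominates a term for \<open>A\<close>, taken at a translate of the finite set.\<close>

lemma H_alg_quot:
  assumes E: "finite E" "E \<subseteq> carrier A" "\<one>\<^bsub>A\<^esub> \<in> E"
  shows "H_alg S (A Mod ker) (induced_action A ker lam) (quot_map ` E) = H_alg S A lam E"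
proof -
  let ?g = "mean_growth A lam E"
    and ?h = "mean_growth (A Mod ker) (induced_action A ker lam) (quot_map ` E)"
  have E0: "E \<noteq> {}" using E(3) by blast
  have qE: "finite (quot_map ` E)" "quot_map ` E \<subseteq> carrier (A Mod ker)"
    "\<one>\<^bsub>A Mod ker\<^esub> \<in> quot_map ` E"
    using E unfolding carrier_quot quot_map_one[symmetric] by auto
  have bdd: "bdd_below (?g ` finite_parts S)" "bdd_below (?h ` finite_parts S)"
    using mean_growth_nonneg Q.mean_growth_nonneg by (auto intro!: bdd_belowI[of _ 0])
  have "{\<one>\<^bsub>S\<^esub>} \<in> finite_parts S" by (simp add: finite_parts_def)
  then have ne: "finite_parts S \<noteq> {}" by blast
  have "(INF F\<in>finite_parts S. ?h F) = (INF F\<in>finite_parts S. ?g F)"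
  proof (rule antisym)
    show "(INF F\<in>finite_parts S. ?h F) \<le> (INF F\<in>finite_parts S. ?g F)"
      using mean_growth_quot_le[OF E(1,2) E0] by (intro cINF_mono[OF ne bdd(2)]) blast
    show "(INF F\<in>finite_parts S. ?g F) \<le> (INF F\<in>finite_parts S. ?h F)"
      using mean_growth_quot_ge[OF E(1,2) E0] by (intro cINF_mono[OF ne bdd(1)])
  qed
  then show ?thesis
    using H_alg_eq_INF[OF amenable E] Q.H_alg_eq_INF[OF amenable qE] by simp
qed

text \<open>Finite sets of cosets lift to finite sets of representatives. Inserting the neutral
  element keeps the image, since \<open>D\<close> already contains its coset.\<close>

lemma finite_subset_quot:
  assumes "finite D" "D \<subseteq> carrier (A Mod ker)" "\<one>\<^bsub>A Mod ker\<^esub> \<in> D"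
  obtains E where "finite E" "E \<subseteq> carrier A" "\<one>\<^bsub>A\<^esub> \<in> E" "D = quot_map ` E"
proof -
  obtain E where E: "E \<subseteq> carrier A" "finite E" "D = quot_map ` E"
    using finite_subset_image[OF assms(1) assms(2)[unfolded carrier_quot]] by blast
  have "quot_map ` insert \<one>\<^bsub>A\<^esub> E = D"
    using assms(3) unfolding image_insert quot_map_one E(3)[symmetric] by (rule insert_absorb)
  then show thesis using E(1,2) that[of "insert \<one>\<^bsub>A\<^esub> E"] by simp
qed

text \<open>Images under the quotient map carry the admissible finite subsets of \<open>A\<close>
  onto those of the quotient and preserve \<open>H_alg\<close>, so both suprema range over the same
  values.\<close>

lemma h_alg_quot: "h_alg S (A Mod ker) (induced_action A ker lam) = h_alg S A lam"
proof -
  let ?EA = "{E. finite E \<and> E \<subseteq> carrier A \<and> \<one>\<^bsub>A\<^esub> \<in> E}"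
    and ?EQ = "{E. finite E \<and> E \<subseteq> carrier (A Mod ker) \<and> \<one>\<^bsub>A Mod ker\<^esub> \<in> E}"
  have "?EQ = (`) quot_map ` ?EA"
  proof
    show "?EQ \<subseteq> (`) quot_map ` ?EA"
    proof
      fix D assume "D \<in> ?EQ"
      then obtain E where "finite E" "E \<subseteq> carrier A" "\<one>\<^bsub>A\<^esub> \<in> E" "D = quot_map ` E"
        using finite_subset_quot by blast
      then show "D \<in> (`) quot_map ` ?EA" by blast
    qed
    show "(`) quot_map ` ?EA \<subseteq> ?EQ"
      unfolding carrier_quot quot_map_one[symmetric] by auto
  qed
  then show ?thesis
    unfolding h_alg_def by (simp add: image_image H_alg_quot)
qed

end

theorem proposition2p4:
  fixes S :: "('s, 'm) monoid_scheme"
    and A :: "('x, 'n) monoid_scheme"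
    and lam :: "'s \<Rightarrow> 'x \<Rightarrow> 'x"
  assumes "monoid_cancel S" and "right_amenable S"
    and "comm_group A" and "left_action S A lam"
  shows "h_alg S A lam =
    h_alg S (A Mod action_kernel S A lam) (induced_action A (action_kernel S A lam) lam)"
proof -
  interpret amenable_action S A lam
    using assms by (simp add: amenable_action_def amenable_action_axioms_def cancel_action_def
        cancel_action_axioms_def)
  show ?thesis by (rule h_alg_quot[symmetric])
qed

end
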